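(* Let $X$ and $Y$ be non-zero complex Banach spaces such that $Y$ is separable and reflexive. Assume $X$ satisfies one of the following: (1) $X=L_p[0,1]$, where $1<p<\infty$; or (2) $X$ is a reflexive Banach space with a subsymmetric Schauder basis. Let $\psi,\phi\colon\mathcal{B}(X)\to\mathcal{B}(Y)$ be algebra homomorphisms such that $\psi$ is surjective. If $$\|\psi(A)-\phi(A)\|<\|A\|$$ for each non-zero $A\in\mathcal{B}(X)$, then $\phi$ is an isomorphism of Banach algebras.
   Context: All Banach spaces are complex. $\mathcal{B}(X)$ is the Banach algebra of bounded linear operators on $X$ with the operator norm. Algebra homomorphisms are linear and multiplicative (not assumed unital or continuous). An isomorphism of Banach algebras is an algebra homomorphism which is also a homeomorphism (in particular bijective). A Schauder basis $(b_n)_{n\in\mathbb{N}}$ of $X$ is subsymmetric if it is unconditional and, for every strictly increasing $\sigma\colon\mathbb{N}\to\mathbb{N}$, the basic sequence $(b_{\sigma(n)})_{n\in\mathbb{N}}$ is equivalent to $(b_n)_{n\in\mathbb{N}}$. $L_p[0,1]$ is taken with respect to Lebesgue measure. *)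

theory Defs
  imports "HOL-Analysis.Analysis"
begin

class complex_normed_vector = real_normed_vector +
  fixes scaleC :: "complex \<Rightarrow> 'a \<Rightarrow> 'a"  (infixr "*\<^sub>C" 75)
  assumes scaleC_add_right: "c *\<^sub>C (x + y) = c *\<^sub>C x + c *\<^sub>C y"
    and scaleC_add_left: "(c + d) *\<^sub>C x = c *\<^sub>C x + d *\<^sub>C x"
    and scaleC_scaleC: "c *\<^sub>C d *\<^sub>C x = (c * d) *\<^sub>C x"
    and scaleR_scaleC: "r *\<^sub>R x = complex_of_real r *\<^sub>C x"
    and norm_scaleC: "norm (c *\<^sub>C x) = cmod c * norm x"

class complex_banach = complex_normed_vector + banach

instantiation complex :: complex_banach
begin

definition scaleC_complex :: "complex \<Rightarrow> complex \<Rightarrow> complex" where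
  "scaleC_complex c x = c * x"

instance
  by standard (simp_all add: scaleC_complex_def algebra_simps scaleR_conv_of_real norm_mult)

end

lemma scaleC_one: "1 *\<^sub>C (x::'a::complex_normed_vector) = x"
  using scaleR_scaleC[of 1 x] by simp

lemma scaleC_zero_right: "c *\<^sub>C (0::'a::complex_normed_vector) = 0"
  using norm_scaleC[of c "0::'a"] by simp

lemma scaleC_minus_right: "c *\<^sub>C (- x) = - (c *\<^sub>C (x::'a::complex_normed_vector))"
  using scaleC_add_right[of c x "- x"]
  by (simp add: scaleC_zero_right add_eq_0_iff)

lemma scaleC_diff_right:
  "c *\<^sub>C (x - y) = c *\<^sub>C x - c *\<^sub>C (y::'a::complex_normed_vector)"
  using scaleC_add_right[of c x "- y"] by (simp add: scaleC_minus_right)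

lemma bounded_linear_scaleC_right:
  "bounded_linear (\<lambda>x::'a::complex_normed_vector. c *\<^sub>C x)"
  by (rule bounded_linear_intro[where K = "cmod c"])
    (simp_all add: scaleC_add_right scaleR_scaleC scaleC_scaleC norm_scaleC mult.commute)

lemma onorm_scaleC_le:
  fixes f :: "'a::real_normed_vector \<Rightarrow> 'b::complex_normed_vector"
  assumes "bounded_linear f"
  shows "onorm (\<lambda>x. c *\<^sub>C f x) \<le> cmod c * onorm f"
proof (rule onorm_bound)
  show "0 \<le> cmod c * onorm f"
    by (simp add: onorm_pos_le[OF assms])
  show "norm (c *\<^sub>C f x) \<le> cmod c * onorm f * norm x" for x
    using mult_left_mono[OF onorm[OF assms, of x], of "cmod c"]
    by (simp add: norm_scaleC mult.assoc)
qed

lemma onorm_scaleC: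
  fixes f :: "'a::real_normed_vector \<Rightarrow> 'b::complex_normed_vector"
  assumes "bounded_linear f"
  shows "onorm (\<lambda>x. c *\<^sub>C f x) = cmod c * onorm f"
proof (cases "c = 0")
  case True
  have "0 *\<^sub>C f x = 0" for x
    using norm_scaleC[of 0 "f x"] by simp
  then show ?thesis
    using True by (simp add: onorm_zero)
next
  case False
  have "bounded_linear (\<lambda>x. c *\<^sub>C f x)"
    by (rule bounded_linear_compose[OF bounded_linear_scaleC_right assms])
  from onorm_scaleC_le[OF this, of "inverse c"]
  have "onorm f \<le> inverse (cmod c) * onorm (\<lambda>x. c *\<^sub>C f x)"
    using False by (simp add: scaleC_scaleC scaleC_one norm_inverse)
  then have "cmod c * onorm f \<le> onorm (\<lambda>x. c *\<^sub>C f x)"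
    using False by (simp add: field_simps)
  with onorm_scaleC_le[OF assms, of c] show ?thesis
    by simp
qed

text \<open>The library predicate \<^const>\<open>bounded_linear\<close> only asks for real linearity.\<close>

typedef (overloaded) ('a::complex_normed_vector, 'b::complex_normed_vector) cblinfun =
  "{f :: 'a \<Rightarrow> 'b. bounded_linear f \<and> (\<forall>c x. f (c *\<^sub>C x) = c *\<^sub>C f x)}"
  morphisms cblinfun_apply CBlinfun
  by (rule exI[of _ "\<lambda>_. 0"]) (simp add: scaleC_zero_right)

declare [[coercion "cblinfun_apply :: ('a::complex_normed_vector, 'b::complex_normed_vector) cblinfun \<Rightarrow> 'a \<Rightarrow> 'b"]]

setup_lifting type_definition_cblinfun

instantiation cblinfun :: (complex_normed_vector, complex_normed_vector) complex_normed_vector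
begin

lift_definition norm_cblinfun :: "('a, 'b) cblinfun \<Rightarrow> real" is onorm .

lift_definition zero_cblinfun :: "('a, 'b) cblinfun" is "\<lambda>_. 0"
  by (simp add: scaleC_zero_right)

lift_definition plus_cblinfun ::
    "('a, 'b) cblinfun \<Rightarrow> ('a, 'b) cblinfun \<Rightarrow> ('a, 'b) cblinfun" is "\<lambda>f g x. f x + g x"
  by (simp add: bounded_linear_add scaleC_add_right)

lift_definition minus_cblinfun ::
    "('a, 'b) cblinfun \<Rightarrow> ('a, 'b) cblinfun \<Rightarrow> ('a, 'b) cblinfun" is "\<lambda>f g x. f x - g x"
  by (simp add: bounded_linear_sub scaleC_diff_right)

lift_definition uminus_cblinfun :: "('a, 'b) cblinfun \<Rightarrow> ('a, 'b) cblinfun" is "\<lambda>f x. - f x"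
  by (simp add: bounded_linear_minus scaleC_minus_right)

lift_definition scaleC_cblinfun :: "complex \<Rightarrow> ('a, 'b) cblinfun \<Rightarrow> ('a, 'b) cblinfun"
  is "\<lambda>c f x. c *\<^sub>C f x"
  by (simp add: bounded_linear_compose[OF bounded_linear_scaleC_right] scaleC_scaleC mult.commute)

definition scaleR_cblinfun :: "real \<Rightarrow> ('a, 'b) cblinfun \<Rightarrow> ('a, 'b) cblinfun" where
  "scaleR_cblinfun r A = complex_of_real r *\<^sub>C A"

definition dist_cblinfun :: "('a, 'b) cblinfun \<Rightarrow> ('a, 'b) cblinfun \<Rightarrow> real" where
  "dist_cblinfun A B = norm (A - B)"

definition sgn_cblinfun :: "('a, 'b) cblinfun \<Rightarrow> ('a, 'b) cblinfun" where
  "sgn_cblinfun A = inverse (norm A) *\<^sub>R A"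

definition [code del]: "(uniformity :: (('a, 'b) cblinfun \<times> ('a, 'b) cblinfun) filter) =
  (INF e\<in>{0 <..}. principal {(A, B). dist A B < e})"

definition open_cblinfun :: "('a, 'b) cblinfun set \<Rightarrow> bool" where [code del]:
  "open_cblinfun S = (\<forall>A\<in>S. \<forall>\<^sub>F (A', B) in uniformity. A' = A \<longrightarrow> B \<in> S)"

instance
proof
  fix A B C :: "('a, 'b) cblinfun" and c d :: complex and r s :: real
  show "A + B + C = A + (B + C)" "A + B = B + A" "0 + A = A" "- A + A = 0" "A - B = A + - B"
    by (transfer, force simp: algebra_simps)+
  show add_right: "c *\<^sub>C (A + B) = c *\<^sub>C A + c *\<^sub>C B"
    by transfer (simp add: scaleC_add_right)
  show add_left: "(c + d) *\<^sub>C A = c *\<^sub>C A + d *\<^sub>C A" for c d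
    by transfer (simp add: scaleC_add_left)
  show scaleC: "c *\<^sub>C d *\<^sub>C A = (c * d) *\<^sub>C A" for c d
    by transfer (simp add: scaleC_scaleC)
  show norm: "norm (c *\<^sub>C A) = cmod c * norm A" for c
    by transfer (simp add: onorm_scaleC)
  show "r *\<^sub>R A = complex_of_real r *\<^sub>C A"
    by (simp add: scaleR_cblinfun_def)
  show "r *\<^sub>R (A + B) = r *\<^sub>R A + r *\<^sub>R B"
    unfolding scaleR_cblinfun_def by transfer (simp add: scaleC_add_right)
  show "(r + s) *\<^sub>R A = r *\<^sub>R A + s *\<^sub>R A" "r *\<^sub>R s *\<^sub>R A = (r * s) *\<^sub>R A"
    by (simp_all add: scaleR_cblinfun_def add_left scaleC)
  show "1 *\<^sub>R A = A"
    unfolding scaleR_cblinfun_def by transfer (simp add: scaleC_one)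
  show "norm (r *\<^sub>R A) = \<bar>r\<bar> * norm A"
    by (simp add: scaleR_cblinfun_def norm)
  show "norm A = 0 \<longleftrightarrow> A = 0"
    by transfer (auto simp: onorm_eq_0)
  show "norm (A + B) \<le> norm A + norm B"
    by transfer (simp add: onorm_triangle)
qed (fact dist_cblinfun_def sgn_cblinfun_def uniformity_cblinfun_def open_cblinfun_def)+

end

lift_definition cblinfun_compose ::
    "('b::complex_normed_vector, 'c::complex_normed_vector) cblinfun \<Rightarrow>
     ('a::complex_normed_vector, 'b) cblinfun \<Rightarrow> ('a, 'c) cblinfun"  (infixl "o\<^sub>C" 67)
  is "(\<circ>)"
  by (simp add: bounded_linear_compose comp_def)

lemma norm_cblinfun_apply: "norm (cblinfun_apply A x) \<le> norm A * norm x"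
  by transfer (simp add: onorm)

type_synonym 'a bounded_operator = "('a, 'a) cblinfun"

type_synonym 'a topological_dual = "('a, complex) cblinfun"

lift_definition bidual_embedding ::
    "'a::complex_normed_vector \<Rightarrow> 'a topological_dual topological_dual"
  is "\<lambda>x (f :: 'a topological_dual). cblinfun_apply f x"
  by (auto intro!: bounded_linear_intro norm_cblinfun_apply
      simp: plus_cblinfun.rep_eq scaleR_scaleC scaleC_cblinfun.rep_eq)

definition reflexive_space :: "'a::complex_normed_vector itself \<Rightarrow> bool" where
  "reflexive_space _ \<longleftrightarrow> surj (bidual_embedding :: 'a \<Rightarrow> _)"

definition schauder_basis :: "(nat \<Rightarrow> 'a::complex_normed_vector) \<Rightarrow> bool" where
  "schauder_basis b \<longleftrightarrow> (\<forall>x. \<exists>!a :: nat \<Rightarrow> complex. (\<lambda>n. a n *\<^sub>C b n) sums x)"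

definition unconditional_basis :: "(nat \<Rightarrow> 'a::complex_normed_vector) \<Rightarrow> bool" where
  "unconditional_basis b \<longleftrightarrow> schauder_basis b \<and>
     (\<forall>a :: nat \<Rightarrow> complex. summable (\<lambda>n. a n *\<^sub>C b n) \<longrightarrow>
        (\<forall>\<pi>. bij \<pi> \<longrightarrow> summable (\<lambda>n. a (\<pi> n) *\<^sub>C b (\<pi> n))))"

definition equivalent_basic_sequences ::
    "(nat \<Rightarrow> 'a::complex_normed_vector) \<Rightarrow> (nat \<Rightarrow> 'b::complex_normed_vector) \<Rightarrow> bool" where
  "equivalent_basic_sequences b d \<longleftrightarrow>
     (\<forall>a :: nat \<Rightarrow> complex. summable (\<lambda>n. a n *\<^sub>C b n) \<longleftrightarrow> summable (\<lambda>n. a n *\<^sub>C d n))"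

text \<open>Every subsequence of a Schauder basis of a Banach space is a basic sequence, so this
  need not be required separately.\<close>

definition subsymmetric_basis :: "(nat \<Rightarrow> 'a::complex_normed_vector) \<Rightarrow> bool" where
  "subsymmetric_basis b \<longleftrightarrow> unconditional_basis b \<and>
     (\<forall>\<sigma> :: nat \<Rightarrow> nat. strict_mono \<sigma> \<longrightarrow> equivalent_basic_sequences (\<lambda>n. b (\<sigma> n)) b)"

definition Lp_functions :: "real \<Rightarrow> (real \<Rightarrow> complex) set" where
  "Lp_functions p = {f \<in> borel_measurable (lebesgue_on {0..1}).
     integrable (lebesgue_on {0..1}) (\<lambda>t. cmod (f t) powr p)}"

definition Lp_seminorm :: "real \<Rightarrow> (real \<Rightarrow> complex) \<Rightarrow> real" where
  "Lp_seminorm p f = (LINT t|lebesgue_on {0..1}. cmod (f t) powr p) powr (1 / p)"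

text \<open>The space \<open>L\<^sub>p[0,1]\<close> is the quotient of the seminormed space of \<open>p\<close>-integrable functions by
  the functions of seminorm 0. A type cannot depend on \<open>p\<close>, so it is described by its quotient
  map \<open>q\<close>: a linear map onto the space that carries the seminorm to the norm. Its kernel then
  consists of the functions that vanish almost everywhere on \<open>[0,1]\<close>, and any two spaces with
  such a map are isometrically isomorphic.\<close>

definition is_Lp_space :: "real \<Rightarrow> 'a::complex_normed_vector itself \<Rightarrow> bool" where
  "is_Lp_space p _ \<longleftrightarrow> (\<exists>q :: (real \<Rightarrow> complex) \<Rightarrow> 'a.
     (\<forall>f\<in>Lp_functions p. \<forall>g\<in>Lp_functions p. q (\<lambda>t. f t + g t) = q f + q g) \<and>
     (\<forall>c. \<forall>f\<in>Lp_functions p. q (\<lambda>t. c * f t) = c *\<^sub>C q f) \<and>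
     (\<forall>f\<in>Lp_functions p. norm (q f) = Lp_seminorm p f) \<and>
     q ` Lp_functions p = UNIV)"

definition algebra_hom ::
    "('a::complex_normed_vector bounded_operator \<Rightarrow> 'b::complex_normed_vector bounded_operator)
      \<Rightarrow> bool" where
  "algebra_hom \<phi> \<longleftrightarrow>
     (\<forall>A B. \<phi> (A + B) = \<phi> A + \<phi> B) \<and>
     (\<forall>c A. \<phi> (c *\<^sub>C A) = c *\<^sub>C \<phi> A) \<and>
     (\<forall>A B. \<phi> (A o\<^sub>C B) = \<phi> A o\<^sub>C \<phi> B)"

definition banach_algebra_iso ::
    "('a::complex_normed_vector bounded_operator \<Rightarrow> 'b::complex_normed_vector bounded_operator)
      \<Rightarrow> bool" where
  "banach_algebra_iso \<phi> \<longleftrightarrow> algebra_hom \<phi> \<and> (\<exists>\<theta>. homeomorphism UNIV UNIV \<phi> \<theta>)"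

end

(* A homomorphism into B(Y) with Y separable that kills the rank-one operators kills the identity as soon
   as X carries uncountably many pairs U a, V a with V a U a = 1 and V a U b of finite rank for a distinct
   from b: otherwise the images of the U a V a are uncountably many nonzero idempotents with pairwise
   products 0, uncountably many of them are bounded by one constant, and unit vectors in their ranges are
   uniformly separated. For a subsymmetric basis such a family comes from an almost disjoint family of
   infinite subsets of the naturals. On L_p, realised on the coin-tossing space, U a f reads only the coins
   indexed by the a-th set and V a averages over the other ones, so neither the Haar basis nor duality is
   needed.

   Consequently psi is spatial, psi(A) = T A T^-1, and X is reflexive because Y is. Let P be a rank-one
   projection of norm 1. Then psi(P) has rank one and so has phi(P), as the two idempotents are at distance
   less than 1. This yields an intertwiner S from X to Y for phi; by reflexivity it has an intertwining
   left inverse R. The homomorphism phi(A) - S A R kills the rank-one operators, so phi(1) = S R. Finally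
   1 - S R is an idempotent of norm less than 1, hence S R = 1. *)
theory Submission
  imports Defs "HOL-Probability.Probability"
begin

text \<open>The hypothesis does its main work at two operators of norm 1, a rank-one projection and
  the identity, where it produces an operator on Y of norm less than 1. At the remaining operators
  it bounds phi by a multiple of the norm, because psi is bounded as soon as it is known to be
  spatial. The obstacle is that no continuity is given at the outset and that phi is not known to be
  surjective. For psi, surjectivity makes the intertwiner onto, and the closed graph theorem then
  makes it bounded. For phi, boundedness is borrowed from psi, and the missing surjectivity of S is
  made up for by the left inverse R together with the smallness of 1 - S R. Zabreiko's lemma on
  countably subadditive seminorms is the common source of the closed graph theorem and of the
  continuity of basis coordinates; both follow from a single use of Baire's theorem.\<close>

section \<open>Complex-linear bounded operators and rank-one operators\<close>

lemma scaleC_zero_left: "0 *\<^sub>C (x::'a::complex_normed_vector) = 0"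
  using norm_scaleC[of 0 x] by simp

lemma scaleC_sum_right: "c *\<^sub>C (\<Sum>i\<in>S. f i) = (\<Sum>i\<in>S. c *\<^sub>C (f i :: 'a::complex_normed_vector))"
  by (induction S rule: infinite_finite_induct) (simp_all add: scaleC_zero_right scaleC_add_right)

lemma scaleC_sum_left: "(\<Sum>i\<in>S. f i) *\<^sub>C x = (\<Sum>i\<in>S. f i *\<^sub>C (x :: 'a::complex_normed_vector))"
  by (induction S rule: infinite_finite_induct) (simp_all add: scaleC_zero_left scaleC_add_left)

lemma scaleC_eq_0_iff: "c *\<^sub>C x = 0 \<longleftrightarrow> c = 0 \<or> (x::'a::complex_normed_vector) = 0"
  by (metis norm_scaleC norm_eq_zero mult_eq_0_iff)

lemma bounded_linear_cblinfun_apply: "bounded_linear (cblinfun_apply A)"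
  using cblinfun_apply[of A] by simp

lemma cblinfun_apply_scaleC: "cblinfun_apply A (c *\<^sub>C x) = c *\<^sub>C cblinfun_apply A x"
  using cblinfun_apply[of A] by simp

lemmas cblinfun_apply_add = bounded_linear_cblinfun_apply[THEN bounded_linear.linear, THEN linear_add]
lemmas cblinfun_apply_diff = bounded_linear_cblinfun_apply[THEN bounded_linear.linear, THEN linear_diff]
lemmas cblinfun_apply_zero = bounded_linear_cblinfun_apply[THEN bounded_linear.linear, THEN linear_0]
lemmas cblinfun_apply_sum = bounded_linear_cblinfun_apply[THEN bounded_linear.linear, THEN linear_sum]

lemmas cblinfun_rep_eqs = zero_cblinfun.rep_eq plus_cblinfun.rep_eq minus_cblinfun.rep_eq
  uminus_cblinfun.rep_eq scaleC_cblinfun.rep_eq cblinfun_compose.rep_eq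

lemma cblinfun_eqI: "(\<And>x. cblinfun_apply A x = cblinfun_apply B x) \<Longrightarrow> A = B"
  by (metis cblinfun_apply_inject ext)

lemma cblinfun_exists:
  fixes f :: "'a::complex_normed_vector \<Rightarrow> 'b::complex_normed_vector"
  assumes "\<And>x y. f (x + y) = f x + f y" "\<And>c x. f (c *\<^sub>C x) = c *\<^sub>C f x"
    and "\<And>x. norm (f x) \<le> K * norm x"
  shows "\<exists>A. cblinfun_apply A = f"
proof -
  have "bounded_linear f"
    by (rule bounded_linear_intro[where K = K]) (use assms in \<open>simp_all add: scaleR_scaleC mult.commute\<close>)
  then show ?thesis
    using CBlinfun_inverse[of f] assms(2) by auto
qed

lemma norm_cblinfun_bound:
  "0 \<le> K \<Longrightarrow> (\<And>x. norm (cblinfun_apply A x) \<le> K * norm x) \<Longrightarrow> norm A \<le> K"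
  by transfer (simp add: onorm_bound)

lemma norm_cblinfun_compose: "norm (A o\<^sub>C B) \<le> norm A * norm B"
proof (rule norm_cblinfun_bound)
  show "norm (cblinfun_apply (A o\<^sub>C B) x) \<le> norm A * norm B * norm x" for x
    using norm_cblinfun_apply[of A "B x"] mult_left_mono[OF norm_cblinfun_apply[of B x], of "norm A"]
    by (simp add: cblinfun_rep_eqs mult.assoc)
qed simp

lift_definition id_cblinfun :: "('a::complex_normed_vector, 'a) cblinfun" is "\<lambda>x. x"
  by simp

text \<open>The elementary tensor x \<otimes> f. The composition rules below make these operators
  behave like matrix units.\<close>

lift_definition rank_one :: "'b::complex_normed_vector \<Rightarrow> 'a::complex_normed_vector topological_dual \<Rightarrow> ('a, 'b) cblinfun"
  is "\<lambda>x f y. cblinfun_apply f y *\<^sub>C x"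
proof safe
  fix x :: 'b and f :: "'a topological_dual"
  show "bounded_linear (\<lambda>y. cblinfun_apply f y *\<^sub>C x)"
    by (rule bounded_linear_intro[where K = "norm f * norm x"])
      (use mult_right_mono[OF norm_cblinfun_apply[of f], of "norm x"] in
        \<open>auto simp: cblinfun_apply_add scaleC_add_left scaleR_scaleC cblinfun_apply_scaleC
          scaleC_complex_def scaleC_scaleC norm_scaleC mult_ac\<close>)
  show "cblinfun_apply f (c *\<^sub>C y) *\<^sub>C x = c *\<^sub>C cblinfun_apply f y *\<^sub>C x" for c y
    by (simp add: cblinfun_apply_scaleC scaleC_complex_def scaleC_scaleC)
qed

lemma norm_rank_one_le: "norm (rank_one x f) \<le> norm x * norm f"
  by (rule norm_cblinfun_bound)
    (use mult_right_mono[OF norm_cblinfun_apply[of f], of "norm x"] in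
      \<open>auto simp: rank_one.rep_eq norm_scaleC mult_ac\<close>)

lemma cblinfun_compose_rank_one: "A o\<^sub>C rank_one x f = rank_one (A x) f"
  by (rule cblinfun_eqI) (simp add: cblinfun_rep_eqs rank_one.rep_eq cblinfun_apply_scaleC)

lemma rank_one_compose: "rank_one x f o\<^sub>C A = rank_one x (f o\<^sub>C A)"
  by (rule cblinfun_eqI) (simp add: cblinfun_rep_eqs rank_one.rep_eq)

lemma rank_one_compose_rank_one: "rank_one x f o\<^sub>C rank_one y g = f y *\<^sub>C rank_one x g"
  by (rule cblinfun_eqI) (simp add: cblinfun_rep_eqs rank_one.rep_eq cblinfun_apply_scaleC
      scaleC_complex_def scaleC_scaleC mult.commute)

lemma rank_one_add_left: "rank_one (x + y) f = rank_one x f + rank_one y f"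
  and rank_one_scaleC_left: "rank_one (c *\<^sub>C x) f = c *\<^sub>C rank_one x f"
  and rank_one_add_right: "rank_one x (f + g) = rank_one x f + rank_one x g"
  and rank_one_scaleC_right: "rank_one x (c *\<^sub>C f) = c *\<^sub>C rank_one x f"
  by (rule cblinfun_eqI; simp add: cblinfun_rep_eqs rank_one.rep_eq scaleC_add_right scaleC_scaleC
      scaleC_add_left scaleC_complex_def mult.commute)+

lemma id_cblinfun_compose [simp]: "id_cblinfun o\<^sub>C A = A" "A o\<^sub>C id_cblinfun = A"
  by (rule cblinfun_eqI; simp add: cblinfun_rep_eqs id_cblinfun.rep_eq)+

lemma zero_cblinfun_compose [simp]: "0 o\<^sub>C A = 0" "A o\<^sub>C 0 = 0"
  by (rule cblinfun_eqI; simp add: cblinfun_rep_eqs cblinfun_apply_zero)+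

lemma cblinfun_compose_assoc: "A o\<^sub>C B o\<^sub>C C = A o\<^sub>C (B o\<^sub>C C)"
  by (rule cblinfun_eqI) (simp add: cblinfun_rep_eqs)

section \<open>The Hahn--Banach theorem\<close>

text \<open>Graphs of partial functionals are treated as subspaces of the product; domination by the norm
  makes them single-valued.\<close>

lemma Hahn_Banach_real:
  fixes x0 :: "'a::real_normed_vector"
  shows "\<exists>u. linear u \<and> (\<forall>x. u x \<le> norm x) \<and> u x0 = norm x0"
proof -
  define A where "A = {G :: ('a \<times> real) set. subspace G \<and> (x0, norm x0) \<in> G \<and> (\<forall>(x, r)\<in>G. r \<le> norm x)}"
  have "span {(x0, norm x0)} \<in> A"
  proof -
    have "r \<le> norm x" if "(x, r) \<in> span {(x0, norm x0)}" for x r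
      using that by (auto simp: span_singleton intro!: mult_right_mono)
    then show ?thesis
      unfolding A_def by (auto simp: span_base subspace_span)
  qed
  then have "A \<noteq> {}" by blast
  moreover have "\<Union>C \<in> A" if "C \<noteq> {}" and C: "subset.chain A C" for C
  proof -
    have CA: "C \<subseteq> A" and tot: "\<And>G H. G \<in> C \<Longrightarrow> H \<in> C \<Longrightarrow> G \<subseteq> H \<or> H \<subseteq> G"
      using C by (auto simp: subset_chain_def)
    have "subspace (\<Union>C)"
    proof (rule subspaceI)
      show "0 \<in> \<Union>C"
        using \<open>C \<noteq> {}\<close> CA by (fastforce simp: A_def intro: subspace_0)
      show "v + w \<in> \<Union>C" if vw: "v \<in> \<Union>C" "w \<in> \<Union>C" for v w
      proof -
        obtain G H where GH: "G \<in> C" "H \<in> C" "v \<in> G" "w \<in> H" using vw by blast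
        then obtain K where "K \<in> C" "v \<in> K" "w \<in> K" using tot[of G H] by blast
        then show ?thesis using CA by (auto simp: A_def intro: subspace_add)
      qed
      show "c *\<^sub>R v \<in> \<Union>C" if "v \<in> \<Union>C" for c v
        using that CA by (auto simp: A_def intro: subspace_scale)
    qed
    then show ?thesis
      using CA \<open>C \<noteq> {}\<close> by (fastforce simp: A_def)
  qed
  ultimately obtain M where M: "M \<in> A" and max: "\<And>G. G \<in> A \<Longrightarrow> M \<subseteq> G \<Longrightarrow> G = M"
    using subset_Zorn_nonempty[of A] by blast
  have subM: "subspace M" and x0M: "(x0, norm x0) \<in> M" and le: "\<And>x r. (x, r) \<in> M \<Longrightarrow> r \<le> norm x"
    using M by (auto simp: A_def)
  have ex: "\<exists>r. (y, r) \<in> M" for y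
  proof (rule ccontr)
    assume no: "\<nexists>r. (y, r) \<in> M"
    \<comment> \<open>An extension with value c at y is dominated by the norm exactly if c lies
      above all left-hand sides and below all right-hand sides, so this inequality leaves room for
      c.\<close>
    have bd: "r1 - norm (x1 - y) \<le> norm (x2 + y) - r2" if "(x1, r1) \<in> M" "(x2, r2) \<in> M" for x1 r1 x2 r2
    proof -
      have "(x1 + x2, r1 + r2) \<in> M" using subspace_add[OF subM that] by simp
      then have "r1 + r2 \<le> norm (x1 + x2)" by (rule le)
      also have "\<dots> = norm ((x1 - y) + (x2 + y))" by simp
      also have "\<dots> \<le> norm (x1 - y) + norm (x2 + y)" by (rule norm_triangle_ineq)
      finally show ?thesis by simp
    qed
    define B where "B = (\<lambda>(x, r). r - norm (x - y)) ` M"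
    define c where "c = Sup B"
    have B: "B \<noteq> {}" "bdd_above B"
      using x0M bd[OF _ x0M] by (auto simp: B_def intro!: bdd_aboveI[where M = "norm (x0 + y) - norm x0"])
    have c_ge: "r - norm (x - y) \<le> c" if "(x, r) \<in> M" for x r
      unfolding c_def by (rule cSup_upper[OF _ B(2)]) (use that in \<open>force simp: B_def\<close>)
    have c_le: "c \<le> norm (x + y) - r" if "(x, r) \<in> M" for x r
      unfolding c_def by (rule cSup_least[OF B(1)]) (use bd that in \<open>auto simp: B_def\<close>)
    define G where "G = span (insert (y, c) M)"
    have "r \<le> norm x" if "(x, r) \<in> G" for x r
    proof -
      have "\<exists>t. (x, r) - t *\<^sub>R (y, c) \<in> span M"
        using that unfolding G_def span_breakdown_eq .
      then obtain t where "(x, r) - t *\<^sub>R (y, c) \<in> span M" ..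
      then have t: "(x - t *\<^sub>R y, r - t * c) \<in> M"
        using span_eq_iff[THEN iffD2, OF subM] by simp
      consider "t = 0" | "t > 0" | "t < 0" by linarith
      then show ?thesis
      proof cases
        case 1 then show ?thesis using le t by simp
      next
        case 2
        have "(inverse t *\<^sub>R (x - t *\<^sub>R y), inverse t * (r - t * c)) \<in> M"
          using subspace_scale[OF subM t, of "inverse t"] by simp
        from c_le[OF this] have "c \<le> norm (inverse t *\<^sub>R x) - inverse t * (r - t * c)"
          using 2 by (simp add: scaleR_diff_right)
        then have "t * c \<le> t * (norm x / t - (r - t * c) / t)"
          using 2 by (intro mult_left_mono) (auto simp: divide_inverse mult.commute)
        then show ?thesis using 2 by (simp add: field_simps)
      next
        case 3
        have "(inverse (- t) *\<^sub>R (x - t *\<^sub>R y), inverse (- t) * (r - t * c)) \<in> M"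
          using subspace_scale[OF subM t, of "inverse (- t)"] by simp
        moreover have "inverse (- t) *\<^sub>R (x - t *\<^sub>R y) - y = inverse (- t) *\<^sub>R x"
          using 3 by (simp add: scaleR_diff_right)
        ultimately have "inverse (- t) * (r - t * c) - norm (inverse (- t) *\<^sub>R x) \<le> c"
          using c_ge by metis
        then have "(- t) * ((r - t * c) / (- t) - norm x / (- t)) \<le> (- t) * c"
          using 3 by (intro mult_left_mono) (auto simp: divide_inverse mult.commute)
        then show ?thesis using 3 by (simp add: field_simps)
      qed
    qed
    moreover have MG: "M \<subseteq> G" "(y, c) \<in> G"
      unfolding G_def by (auto intro: span_base)
    ultimately have "G \<in> A"
      using x0M by (auto simp: A_def G_def subspace_span)
    then have "G = M" using max MG by blast
    then show False using MG no by blast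
  qed
  have uniq: "r = s" if "(x, r) \<in> M" "(x, s) \<in> M" for x r s
  proof -
    have "(0, r - s) \<in> M" "(0, s - r) \<in> M"
      using subspace_diff[OF subM] that by force+
    from this[THEN le] show ?thesis by simp
  qed
  obtain u where u: "\<And>x. (x, u x) \<in> M" using ex by metis
  have "linear u"
  proof (rule linearI)
    show "u (x + y) = u x + u y" for x y
      using uniq[OF u] subspace_add[OF subM u u, of x y] by simp
    show "u (c *\<^sub>R x) = c *\<^sub>R u x" for c x
      using uniq[OF u] subspace_scale[OF subM u, of c x] by simp
  qed
  moreover have "u x0 = norm x0" using uniq[OF u x0M] .
  ultimately show ?thesis using le u by blast
qed

lemma Hahn_Banach_norming:
  fixes x0 :: "'a::complex_normed_vector"
  shows "\<exists>f :: 'a topological_dual. cblinfun_apply f x0 = complex_of_real (norm x0) \<and> norm f \<le> 1"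
proof -
  obtain u where u: "linear u" "\<And>x. u x \<le> norm x" "u x0 = norm x0"
    using Hahn_Banach_real[of x0] by blast
  \<comment> \<open>F x = u(x) - i u(ix) is the complex-linear functional with real part u.\<close>
  define F where "F x = Complex (u x) (- u (\<i> *\<^sub>C x))" for x :: 'a
  have uadd: "u (x + y) = u x + u y" and uscale: "u (r *\<^sub>R x) = r * u x" for x y r
    using u(1) by (auto simp: linear_add linear_cmul)
  have uscaleC: "u (complex_of_real r *\<^sub>C x) = r * u x" for r x
    using uscale by (simp add: scaleR_scaleC)
  have uneg: "u (- x) = - u x" for x using u(1) by (simp add: linear_neg)
  have Fadd: "F (x + y) = F x + F y" for x y
    by (simp add: F_def uadd scaleC_add_right complex_eq_iff)
  have FscaleC: "F (c *\<^sub>C x) = c * F x" for c x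
  proof -
    have c: "c = complex_of_real (Re c) + complex_of_real (Im c) * \<i>"
      by (simp add: complex_eq_iff)
    have 1: "u (c *\<^sub>C x) = Re c * u x + Im c * u (\<i> *\<^sub>C x)"
      by (subst c) (simp only: scaleC_add_left uadd uscaleC flip: scaleC_scaleC)
    have c2: "\<i> * c = complex_of_real (- Im c) + complex_of_real (Re c) * \<i>"
      by (simp add: complex_eq_iff)
    have 2: "u (\<i> *\<^sub>C c *\<^sub>C x) = - Im c * u x + Re c * u (\<i> *\<^sub>C x)"
      unfolding scaleC_scaleC c2 by (simp only: scaleC_add_left uadd uscaleC flip: scaleC_scaleC)
    show ?thesis
      by (simp add: F_def 1 2 complex_eq_iff)
  qed
  have Fle: "cmod (F x) \<le> norm x" for x
  proof (cases "F x = 0")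
    case False
    \<comment> \<open>A unimodular factor that rotates F x onto the positive real axis, where the
      bound on the real part applies.\<close>
    define c where "c = cnj (F x) / complex_of_real (cmod (F x))"
    have c: "c * F x = complex_of_real (cmod (F x))"
      using False complex_norm_square[of "F x"] by (simp add: c_def field_simps power2_eq_square)
    have "cmod c = 1" using False by (simp add: c_def norm_divide)
    have "cmod (F x) = Re (F (c *\<^sub>C x))"
      by (simp add: FscaleC c)
    also have "\<dots> \<le> norm (c *\<^sub>C x)" using u(2) by (simp add: F_def)
    finally show ?thesis using \<open>cmod c = 1\<close> by (simp add: norm_scaleC)
  qed simp
  obtain f :: "'a topological_dual" where f: "cblinfun_apply f = F"
    using cblinfun_exists[of F 1] Fadd FscaleC Fle by (auto simp: scaleC_complex_def)
  have "norm f \<le> 1" by (rule norm_cblinfun_bound) (simp_all add: f Fle)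
  \<comment> \<open>The real part of F x0 already attains the bound \<open>norm x0\<close> on the
    modulus, which leaves no room for an imaginary part.\<close>
  moreover have "F x0 = complex_of_real (norm x0)"
  proof -
    have "Re (F x0) = norm x0" using u by (simp add: F_def)
    moreover have "(cmod (F x0))\<^sup>2 = (Re (F x0))\<^sup>2 + (Im (F x0))\<^sup>2" by (simp add: cmod_power2)
    moreover have "(cmod (F x0))\<^sup>2 \<le> (norm x0)\<^sup>2" using Fle by (intro power_mono) auto
    ultimately have "Im (F x0) = 0" by simp
    with \<open>Re (F x0) = norm x0\<close> show ?thesis by (simp add: complex_eq_iff)
  qed
  ultimately show ?thesis using f by auto
qed

lemma dual_separates_points:
  fixes x :: "'a::complex_normed_vector"
  assumes "\<And>f :: 'a topological_dual. cblinfun_apply f x = 0"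
  shows "x = 0"
  using Hahn_Banach_norming[of x] assms by auto

section \<open>Countably subadditive seminorms\<close>

text \<open>Baire's theorem makes the closure of some sublevel set contain a ball; countable
  subadditivity then estimates p along a series of approximations. The form with a general seminorm
  covers both \<open>norm (T x)\<close> in the closed graph theorem and
  \<open>basis_norm\<close>.\<close>

lemma Zabreiko:
  fixes p :: "'a::banach \<Rightarrow> real"
  assumes nonneg: "\<And>x. 0 \<le> p x" and scale: "\<And>r x. p (r *\<^sub>R x) = \<bar>r\<bar> * p x"
    and add: "\<And>x y. p (x + y) \<le> p x + p y"
    and csub: "\<And>x s. x sums s \<Longrightarrow> summable (\<lambda>n. p (x n)) \<Longrightarrow> p s \<le> (\<Sum>n. p (x n))"
  shows "\<exists>K. \<forall>x. p x \<le> K * norm x"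
proof -
  define A where "A n = closure {x. p x \<le> real n}" for n :: nat
  have "\<exists>n. interior (A n) \<noteq> {}"
  proof (rule ccontr)
    assume no: "\<nexists>n. interior (A n) \<noteq> {}"
    have "interior (\<Union> (range A)) = {}"
    proof -
      have "euclidean interior_of \<Union> (range A) = {}"
      proof (rule Baire_category_alt)
        show "closedin euclidean T \<and> euclidean interior_of T = {}" if "T \<in> range A" for T
          using that no by (auto simp: A_def)
      qed (auto simp: completely_metrizable_space_euclidean)
      then show ?thesis by simp
    qed
    moreover have "\<Union> (range A) = UNIV"
    proof -
      have "x \<in> A (nat \<lceil>p x\<rceil>)" for x
        unfolding A_def by (rule closure_subset[THEN subsetD]) (simp add: real_nat_ceiling_ge)
      then show ?thesis by blast
    qed
    ultimately show False by simp
  qed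
  then obtain n a where "a \<in> interior (A n)" by blast
  then obtain r where r: "r > 0" "ball a r \<subseteq> A n"
    by (meson mem_interior)
  have approx1: "\<exists>u. p u \<le> real n \<and> norm (x - u) < e" if "norm x < r" "e > 0" for x e
  proof -
    \<comment> \<open>Half the difference of approximants of a + x and a - x approximates x. This
      moves the ball from its centre a to the origin and keeps the bound n.\<close>
    have "a + x \<in> A n" "a - x \<in> A n"
      using r that by (auto simp: dist_norm subset_eq)
    then have "\<exists>v. p v \<le> n \<and> dist v (a + x) < e" "\<exists>w. p w \<le> n \<and> dist w (a - x) < e"
      unfolding A_def using \<open>e > 0\<close> by (auto simp: closure_approachable)
    then obtain v w where v: "p v \<le> n" "dist v (a + x) < e" and w: "p w \<le> n" "dist w (a - x) < e"
      by blast
    define u where "u = (1/2) *\<^sub>R (v + (-1) *\<^sub>R w)"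
    have "p u \<le> (1/2) * (p v + p w)"
      unfolding u_def scale using add[of v "(-1) *\<^sub>R w"] scale[of "-1" w] by simp
    moreover have "x - u = (1/2) *\<^sub>R ((w - (a - x)) - (v - (a + x)))"
    proof -
      have "(w - (a - x)) - (v - (a + x)) = 2 *\<^sub>R (x - u)"
        by (simp add: u_def algebra_simps scaleR_2)
      then show ?thesis by simp
    qed
    then have "norm (x - u) \<le> (1/2) * (norm (w - (a - x)) + norm (v - (a + x)))"
      using norm_triangle_ineq4[of "w - (a - x)" "v - (a + x)"] by simp
    ultimately show ?thesis using v w by (intro exI[of _ u]) (auto simp: dist_norm)
  qed
  have approx: "\<exists>u. p u \<le> real n / 2 ^ k \<and> norm (x - u) < r / 2 ^ Suc k"
    if "norm x < r / 2 ^ k" for x k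
  proof -
    have "norm (2 ^ k *\<^sub>R x) < r" using that by (simp add: field_simps)
    then obtain u where u: "p u \<le> real n" "norm (2 ^ k *\<^sub>R x - u) < r / 2"
      using approx1[of "2 ^ k *\<^sub>R x" "r / 2"] r by auto
    have "x - (1 / 2 ^ k) *\<^sub>R u = (1 / 2 ^ k) *\<^sub>R (2 ^ k *\<^sub>R x - u)"
      by (simp add: scaleR_diff_right)
    then have "norm (x - (1 / 2 ^ k) *\<^sub>R u) = (1 / 2 ^ k) * norm (2 ^ k *\<^sub>R x - u)"
      by simp
    also have "\<dots> < (1 / 2 ^ k) * (r / 2)"
      using u(2) by (intro mult_strict_left_mono) auto
    finally have "norm (x - (1 / 2 ^ k) *\<^sub>R u) < r / 2 ^ Suc k" by (simp add: field_simps)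
    moreover have "p ((1 / 2 ^ k) *\<^sub>R u) \<le> real n / 2 ^ k"
      using u(1) by (simp add: scale field_simps)
    ultimately show ?thesis by blast
  qed
  then have "\<forall>x k. \<exists>u. norm x < r / 2 ^ k \<longrightarrow> p u \<le> real n / 2 ^ k \<and> norm (x - u) < r / 2 ^ Suc k"
    by blast
  then obtain g where "\<forall>x k. norm x < r / 2 ^ k \<longrightarrow> p (g x k) \<le> real n / 2 ^ k \<and> norm (x - g x k) < r / 2 ^ Suc k"
    unfolding choice_iff by blast
  then have g: "\<And>x k. norm x < r / 2 ^ k \<Longrightarrow> p (g x k) \<le> real n / 2 ^ k \<and> norm (x - g x k) < r / 2 ^ Suc k"
    by blast
  have small: "p x \<le> 2 * real n" if x: "norm x < r" for x
  proof -
    \<comment> \<open>\<open>R k\<close> is the remainder after k approximations. It is smaller than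
      r / 2^k, so the k-th approximant costs at most n / 2^k, and the costs add up to 2n.\<close>
    define R where "R = rec_nat x (\<lambda>k y. y - g y k)"
    have R: "R 0 = x" "\<And>k. R (Suc k) = R k - g (R k) k"
      by (simp_all add: R_def)
    have Rn: "norm (R k) < r / 2 ^ k" for k
      by (induction k) (use x g in \<open>auto simp: R\<close>)
    define y where "y k = g (R k) k" for k
    have py: "p (y k) \<le> real n * (1/2) ^ k" for k
      using g[OF Rn[of k]] by (simp add: y_def power_divide)
    have part: "(\<Sum>i<k. y i) = x - R k" for k
      by (induction k) (auto simp: R y_def)
    have "R \<longlonglongrightarrow> 0"
    proof (rule tendsto_norm_zero_cancel, rule real_tendsto_sandwich[where f = "\<lambda>_. 0" and h = "\<lambda>k. r * (1/2) ^ k"])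
      show "(\<lambda>k. r * (1 / 2) ^ k) \<longlonglongrightarrow> 0"
        by (intro tendsto_mult_right_zero LIMSEQ_power_zero) auto
      show "\<forall>\<^sub>F k in sequentially. norm (R k) \<le> r * (1 / 2) ^ k"
        using Rn by (auto intro!: always_eventually less_imp_le simp: power_divide)
    qed auto
    then have "y sums x"
      unfolding sums_def part using tendsto_diff[OF tendsto_const[of x]] by fastforce
    have sg: "(\<lambda>k. real n * (1/2) ^ k) sums (real n * 2)"
      using sums_mult[OF geometric_sums[of "1/2::real"], of "real n"] by simp
    have sp: "summable (\<lambda>k. p (y k))"
      by (rule summable_comparison_test'[OF sums_summable[OF sg]]) (use py nonneg in auto)
    have "p x \<le> (\<Sum>k. p (y k))" using csub[OF \<open>y sums x\<close> sp] .
    also have "\<dots> \<le> real n * 2"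
      using suminf_le[OF py sp sums_summable[OF sg]] sums_unique[OF sg] by simp
    finally show ?thesis by simp
  qed
  have "p x \<le> 4 * real n / r * norm x" for x
  proof (cases "x = 0")
    case True
    then show ?thesis using scale[of 0 x] by simp
  next
    case False
    define c where "c = r / (2 * norm x)"
    have "c > 0" using r False by (simp add: c_def)
    moreover have "norm (c *\<^sub>R x) < r" using r False by (simp add: c_def)
    ultimately have "c * p x \<le> 2 * real n" using small[of "c *\<^sub>R x"] by (simp add: scale)
    then show ?thesis using r False by (simp add: c_def field_simps)
  qed
  then show ?thesis by blast
qed

text \<open>Zabreiko's lemma applies to \<open>norm (T x)\<close>: if the images of the terms of a
  convergent series converge absolutely, closedness identifies their sum with the image of the sum,
  and this is countable subadditivity.\<close>

lemma closed_graph: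
  fixes T :: "'a::banach \<Rightarrow> 'b::banach"
  assumes lin: "linear T"
    and closed: "\<And>x y. x \<longlonglongrightarrow> 0 \<Longrightarrow> (\<lambda>n. T (x n)) \<longlonglongrightarrow> y \<Longrightarrow> y = 0"
  shows "\<exists>K. \<forall>x. norm (T x) \<le> K * norm x"
proof (rule Zabreiko)
  show "norm (T (r *\<^sub>R x)) = \<bar>r\<bar> * norm (T x)" for r x
    using lin by (simp add: linear_cmul)
  show "norm (T (x + y)) \<le> norm (T x) + norm (T y)" for x y
    using lin by (simp add: linear_add norm_triangle_ineq)
  fix x s assume xs: "x sums s" and sm: "summable (\<lambda>n. norm (T (x n)))"
  have smT: "summable (\<lambda>n. T (x n))" using sm by (rule summable_norm_cancel)
  have "(\<lambda>n. (\<Sum>i<n. x i) - s) \<longlonglongrightarrow> 0"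
    using xs unfolding sums_def by (rule LIM_zero)
  moreover have "(\<lambda>n. T ((\<Sum>i<n. x i) - s)) \<longlonglongrightarrow> (\<Sum>n. T (x n)) - T s"
    using lin tendsto_diff[OF summable_LIMSEQ[OF smT] tendsto_const[of "T s"]]
    by (simp add: linear_diff linear_sum)
  ultimately have "T s = (\<Sum>n. T (x n))"
    using closed[of "\<lambda>n. (\<Sum>i<n. x i) - s"] by fastforce
  then show "norm (T s) \<le> (\<Sum>n. norm (T (x n)))"
    using summable_norm[OF sm] by simp
qed simp

lemma closed_graph_cblinfun:
  fixes T :: "'a::complex_banach \<Rightarrow> 'b::complex_banach"
  assumes "\<And>x y. T (x + y) = T x + T y" "\<And>c x. T (c *\<^sub>C x) = c *\<^sub>C T x"
    and "\<And>x y. x \<longlonglongrightarrow> 0 \<Longrightarrow> (\<lambda>n. T (x n)) \<longlonglongrightarrow> y \<Longrightarrow> y = 0"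
  shows "\<exists>A. cblinfun_apply A = T"
proof -
  have "linear T" by (rule linearI) (use assms in \<open>auto simp: scaleR_scaleC\<close>)
  from closed_graph[OF this] assms(3) obtain K where "\<forall>x. norm (T x) \<le> K * norm x" by metis
  then show ?thesis by (intro cblinfun_exists[OF assms(1,2)]) auto
qed

section \<open>Homomorphisms that vanish on rank-one operators\<close>

text \<open>Only a finite family spanning the range is asked for, which is easy to exhibit from
  coordinates; its length is what the next induction runs on.\<close>

definition finite_rank :: "('a::complex_normed_vector, 'b::complex_normed_vector) cblinfun \<Rightarrow> bool" where
  "finite_rank A \<longleftrightarrow> (\<exists>(n::nat) e. \<forall>x. \<exists>c :: nat \<Rightarrow> complex. cblinfun_apply A x = (\<Sum>i<n. c i *\<^sub>C e i))"

text \<open>Induction on the number of spanning vectors. With g (e n) = 1, subtracting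
  \<open>rank_one (e n) (g o\<^sub>C A)\<close> pushes the range into the kernel of g, where the n
  vectors e i - g (e i) e n span it.\<close>

lemma additive_vanishes_on_finite_rank:
  fixes \<theta> :: "('a::complex_normed_vector, 'b::complex_normed_vector) cblinfun \<Rightarrow> 'c::ab_group_add"
  assumes add: "\<And>A B. \<theta> (A + B) = \<theta> A + \<theta> B"
    and rank_one: "\<And>x f. \<theta> (rank_one x f) = 0"
    and fin: "finite_rank A"
  shows "\<theta> A = 0"
proof -
  obtain n :: nat and e where "\<forall>x. \<exists>c :: nat \<Rightarrow> complex. cblinfun_apply A x = (\<Sum>i<n. c i *\<^sub>C e i)"
    using fin unfolding finite_rank_def by blast
  then show ?thesis
  proof (induction n arbitrary: A e)
    case 0
    then have "A = 0" by (intro cblinfun_eqI) (simp add: cblinfun_rep_eqs)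
    moreover have "\<theta> 0 = 0" using add[of 0 0] by simp
    ultimately show ?case by simp
  next
    case (Suc n)
    show ?case
    proof (cases "e n = 0")
      case True
      then show ?thesis using Suc by (intro Suc.IH[of A e]) (simp add: scaleC_zero_right)
    next
      case False
      obtain f :: "'b topological_dual" where f: "cblinfun_apply f (e n) = complex_of_real (norm (e n))"
        using Hahn_Banach_norming by blast
      define g where "g = inverse (complex_of_real (norm (e n))) *\<^sub>C f"
      have g: "cblinfun_apply g (e n) = 1"
        using f False by (simp add: g_def scaleC_cblinfun.rep_eq scaleC_complex_def)
      define B where "B = A - rank_one (e n) (g o\<^sub>C A)"
      have "\<exists>c :: nat \<Rightarrow> complex. cblinfun_apply B x = (\<Sum>i<n. c i *\<^sub>C (e i - cblinfun_apply g (e i) *\<^sub>C e n))" for x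
      proof -
        obtain c :: "nat \<Rightarrow> complex" where c: "cblinfun_apply A x = (\<Sum>i<Suc n. c i *\<^sub>C e i)"
          using Suc.prems by blast
        then have "cblinfun_apply g (cblinfun_apply A x) = (\<Sum>i<n. c i * cblinfun_apply g (e i)) + c n"
          by (simp add: cblinfun_apply_add cblinfun_apply_sum cblinfun_apply_scaleC scaleC_complex_def g)
        then have "cblinfun_apply B x = (\<Sum>i<n. c i *\<^sub>C e i) - (\<Sum>i<n. c i * cblinfun_apply g (e i)) *\<^sub>C e n"
          using c by (simp add: B_def cblinfun_rep_eqs rank_one.rep_eq scaleC_add_left)
        also have "(\<Sum>i<n. c i * cblinfun_apply g (e i)) *\<^sub>C e n = (\<Sum>i<n. c i *\<^sub>C cblinfun_apply g (e i) *\<^sub>C e n)"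
          by (simp add: scaleC_sum_left scaleC_scaleC)
        finally show ?thesis
          by (intro exI[of _ c]) (simp add: scaleC_diff_right sum_subtractf)
      qed
      then have "\<theta> B = 0"
        by (intro Suc.IH[of B "\<lambda>i. e i - cblinfun_apply g (e i) *\<^sub>C e n"]) blast
      moreover have "A = B + rank_one (e n) (g o\<^sub>C A)" by (simp add: B_def)
      ultimately show ?thesis using add[of B "rank_one (e n) (g o\<^sub>C A)"] rank_one by simp
    qed
  qed
qed

text \<open>The operators \<open>U a o\<^sub>C V a\<close> are projections onto copies of the space. All that matters about the
  index type is that it is uncountable.\<close>

definition almost_disjoint_copies :: "'a::complex_normed_vector itself \<Rightarrow> bool" where
  "almost_disjoint_copies _ \<longleftrightarrow> (\<exists>U V :: (nat \<Rightarrow> bool) \<Rightarrow> 'a bounded_operator.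
     (\<forall>a. V a o\<^sub>C U a = id_cblinfun) \<and> (\<forall>a b. a \<noteq> b \<longrightarrow> finite_rank (V a o\<^sub>C U b)))"

text \<open>Cantor's diagonal argument, in the form that the separation argument below
  contradicts.\<close>

lemma uncountable_bool_sequences: "\<nexists>F :: (nat \<Rightarrow> bool) \<Rightarrow> 'a. inj F \<and> countable (range F)"
proof safe
  fix F :: "(nat \<Rightarrow> bool) \<Rightarrow> 'a" assume F: "inj F" "countable (range F)"
  then have "countable (UNIV :: (nat \<Rightarrow> bool) set)"
    using countable_image_inj_on by blast
  then obtain e :: "nat \<Rightarrow> nat \<Rightarrow> bool" where e: "surj e"
    using uncountable_def[of "UNIV :: (nat \<Rightarrow> bool) set"] by auto
  then obtain n where "e n = (\<lambda>k. \<not> e k k)" by (metis surjD)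
  then show False by metis
qed

lemma hom_vanishes_on_id:
  fixes \<theta> :: "'x::complex_normed_vector bounded_operator \<Rightarrow> 'y::complex_normed_vector bounded_operator"
  assumes sep: "separable_space (euclidean :: 'y topology)"
    and copies: "almost_disjoint_copies TYPE('x)"
    and hom: "algebra_hom \<theta>"
    and rank_one: "\<And>x f. \<theta> (rank_one x f) = 0"
  shows "\<theta> id_cblinfun = 0"
proof (rule ccontr)
  assume id: "\<theta> id_cblinfun \<noteq> 0"
  obtain U V :: "(nat \<Rightarrow> bool) \<Rightarrow> 'x bounded_operator"
    where VU: "\<And>a. V a o\<^sub>C U a = id_cblinfun" and fin: "\<And>a b. a \<noteq> b \<Longrightarrow> finite_rank (V a o\<^sub>C U b)"
    using copies unfolding almost_disjoint_copies_def by blast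
  have add: "\<theta> (A + B) = \<theta> A + \<theta> B" and mult: "\<theta> (A o\<^sub>C B) = \<theta> A o\<^sub>C \<theta> B" for A B
    using hom by (auto simp: algebra_hom_def)
  have zero: "\<theta> (V a o\<^sub>C U b) = 0" if "a \<noteq> b" for a b
    by (rule additive_vanishes_on_finite_rank[of \<theta>]) (use add rank_one fin that in auto)
  define e where "e a = \<theta> (U a o\<^sub>C V a)" for a
  have idem: "e a o\<^sub>C e a = e a" for a
  proof -
    have "U a o\<^sub>C V a o\<^sub>C (U a o\<^sub>C V a) = U a o\<^sub>C (V a o\<^sub>C U a) o\<^sub>C V a" by (simp add: cblinfun_compose_assoc)
    then show ?thesis unfolding e_def by (simp add: VU flip: mult)
  qed
  have orth: "e a o\<^sub>C e b = 0" if "a \<noteq> b" for a b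
  proof -
    have "e a o\<^sub>C e b = \<theta> (U a) o\<^sub>C \<theta> (V a o\<^sub>C U b) o\<^sub>C \<theta> (V b)"
      by (simp add: e_def mult cblinfun_compose_assoc)
    then show ?thesis
      by (simp add: zero[OF that])
  qed
  have "\<exists>y. norm y = 1 \<and> cblinfun_apply (e a) y = y" for a
  proof -
    have "e a \<noteq> 0"
    proof
      assume "e a = 0"
      have "id_cblinfun = V a o\<^sub>C (U a o\<^sub>C V a) o\<^sub>C U a"
        by (metis VU cblinfun_compose_assoc id_cblinfun_compose(1))
      then have "\<theta> id_cblinfun = \<theta> (V a) o\<^sub>C e a o\<^sub>C \<theta> (U a)"
        unfolding e_def by (metis mult)
      also have "\<dots> = 0"
        by (simp add: \<open>e a = 0\<close>)
      finally show False using id by simp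
    qed
    then obtain w where w: "cblinfun_apply (e a) w \<noteq> 0"
      by (metis cblinfun_eqI zero_cblinfun.rep_eq)
    define y where "y = inverse (complex_of_real (norm (cblinfun_apply (e a) w))) *\<^sub>C cblinfun_apply (e a) w"
    have "cblinfun_apply (e a) (cblinfun_apply (e a) w) = cblinfun_apply (e a) w"
      using idem[of a] by (metis cblinfun_compose.rep_eq comp_apply)
    then have "cblinfun_apply (e a) y = y" by (simp add: y_def cblinfun_apply_scaleC)
    moreover have "norm y = 1" using w by (simp add: y_def norm_scaleC norm_inverse)
    ultimately show ?thesis by blast
  qed
  then obtain y where y: "\<And>a. norm (y a) = 1" "\<And>a. cblinfun_apply (e a) (y a) = y a" by metis
  obtain D :: "'y set" where D: "countable D" "closure D = UNIV"
    using sep unfolding separable_space_def by auto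
  \<comment> \<open>Indices with equal pairs (m a, d a) have y a and y b at distance less than 1 /
    (m a + 1). But e a fixes y a and kills y b, so that distance is at least 1 / norm (e a). The
    pair is therefore an injective code with countably many values; the summand 1 keeps the radii
    positive without a look at m a.\<close>
  define m where "m a = nat \<lceil>norm (e a)\<rceil>" for a
  have "\<exists>d\<in>D. dist d (y a) < 1 / (2 * (real (m a) + 1))" for a
    using D(2) closure_approachable[of "y a" D] by (metis UNIV_I add_nonneg_pos mult_pos_pos
        of_nat_0_le_iff zero_less_divide_1_iff zero_less_numeral zero_less_one)
  then obtain d where d: "\<And>a. d a \<in> D" "\<And>a. dist (d a) (y a) < 1 / (2 * (real (m a) + 1))" by metis
  have "inj (\<lambda>a. (m a, d a))"
  proof (rule injI)
    fix a b assume eq: "(m a, d a) = (m b, d b)"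
    show "a = b"
    proof (rule ccontr)
      assume "a \<noteq> b"
      have "dist (y a) (y b) \<le> dist (d a) (y a) + dist (d a) (y b)"
        by (metis dist_triangle3)
      also have "\<dots> < 1 / (2 * (real (m a) + 1)) + 1 / (2 * (real (m a) + 1))"
        using d(2)[of a] d(2)[of b] eq by simp
      also have "\<dots> = 1 / (real (m a) + 1)" by (simp add: field_simps)
      finally have small: "norm (y a - y b) < 1 / (real (m a) + 1)" by (simp add: dist_norm)
      have "cblinfun_apply (e a) (y b) = cblinfun_apply (e a o\<^sub>C e b) (y b)"
        by (simp add: cblinfun_rep_eqs y)
      then have "cblinfun_apply (e a) (y a - y b) = y a"
        by (simp add: cblinfun_apply_diff y orth[OF \<open>a \<noteq> b\<close>] cblinfun_rep_eqs)
      then have "1 \<le> norm (e a) * norm (y a - y b)"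
        using norm_cblinfun_apply[of "e a" "y a - y b"] y(1) by simp
      also have "\<dots> \<le> (real (m a) + 1) * norm (y a - y b)"
      proof (rule mult_right_mono)
        show "norm (e a) \<le> real (m a) + 1"
          using real_nat_ceiling_ge[of "norm (e a)"] unfolding m_def by linarith
      qed simp
      also have "\<dots> < (real (m a) + 1) * (1 / (real (m a) + 1))"
        using small by (intro mult_strict_left_mono) auto
      finally show False by simp
    qed
  qed
  moreover have "countable (range (\<lambda>a. (m a, d a)))"
    by (rule countable_subset[of _ "UNIV \<times> D"]) (use d(1) D(1) in auto)
  ultimately show False using uncountable_bool_sequences by blast
qed

section \<open>Surjective homomorphisms\<close>

text \<open>Eidelheit's construction: since A (x \<otimes> f) = (A x) \<otimes> f, for fixed f and y
  the map x \<mapsto> \<phi>(x \<otimes> f) y carries the action of A to that of \<phi>(A).\<close>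

definition intertwiner ::
    "('x::complex_normed_vector bounded_operator \<Rightarrow> 'y::complex_normed_vector bounded_operator)
      \<Rightarrow> 'x topological_dual \<Rightarrow> 'y \<Rightarrow> 'x \<Rightarrow> 'y" where
  "intertwiner \<phi> f y x = cblinfun_apply (\<phi> (rank_one x f)) y"

context
  fixes \<phi> :: "'x::complex_normed_vector bounded_operator \<Rightarrow> 'y::complex_normed_vector bounded_operator"
  assumes hom: "algebra_hom \<phi>"
begin

lemma hom_add: "\<phi> (A + B) = \<phi> A + \<phi> B"
  and hom_scaleC: "\<phi> (c *\<^sub>C A) = c *\<^sub>C \<phi> A"
  and hom_compose: "\<phi> (A o\<^sub>C B) = \<phi> A o\<^sub>C \<phi> B"
  using hom by (auto simp: algebra_hom_def)

lemma hom_zero: "\<phi> 0 = 0"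
  using hom_add[of 0 0] by simp

lemma hom_apply_compose: "cblinfun_apply (\<phi> A) (cblinfun_apply (\<phi> B) y) = cblinfun_apply (\<phi> (A o\<^sub>C B)) y"
  by (simp add: hom_compose cblinfun_rep_eqs)

lemma intertwiner_add: "intertwiner \<phi> f y (x + x') = intertwiner \<phi> f y x + intertwiner \<phi> f y x'"
  and intertwiner_scaleC: "intertwiner \<phi> f y (c *\<^sub>C x) = c *\<^sub>C intertwiner \<phi> f y x"
  by (simp_all add: intertwiner_def rank_one_add_left rank_one_scaleC_left hom_add hom_scaleC cblinfun_rep_eqs)

lemma intertwiner: "cblinfun_apply (\<phi> A) (intertwiner \<phi> f y x) = intertwiner \<phi> f y (cblinfun_apply A x)"
  by (simp add: intertwiner_def hom_apply_compose cblinfun_compose_rank_one)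

text \<open>The kernel of an intertwiner is invariant under every operator, and rank-one operators
  move a non-zero vector to any other vector; so the kernel is either trivial or everything.\<close>

lemma intertwiner_eq_0:
  assumes "intertwiner \<phi> f y x0 \<noteq> 0" "intertwiner \<phi> f y x = 0"
  shows "x = 0"
proof (rule ccontr)
  assume "x \<noteq> 0"
  obtain g :: "'x topological_dual" where g: "cblinfun_apply g x = complex_of_real (norm x)"
    using Hahn_Banach_norming by blast
  have "complex_of_real (norm x) *\<^sub>C intertwiner \<phi> f y x0 = cblinfun_apply (\<phi> (rank_one x0 g)) (intertwiner \<phi> f y x)"
    by (simp add: intertwiner rank_one.rep_eq g intertwiner_scaleC)
  also have "\<dots> = 0" by (simp add: assms cblinfun_apply_zero)
  finally show False using assms(1) \<open>x \<noteq> 0\<close> by (simp add: scaleC_eq_0_iff)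
qed

end

lemma functional_value_one:
  fixes x :: "'a::complex_normed_vector"
  assumes "x \<noteq> 0"
  obtains g :: "'a topological_dual" where "cblinfun_apply g x = 1"
proof -
  obtain f :: "'a topological_dual" where f: "cblinfun_apply f x = complex_of_real (norm x)"
    using Hahn_Banach_norming by blast
  show thesis
    by (rule that[of "inverse (complex_of_real (norm x)) *\<^sub>C f"])
      (use f assms in \<open>simp add: scaleC_cblinfun.rep_eq scaleC_complex_def\<close>)
qed

lemma id_cblinfun_neq_0: "(y::'a::complex_normed_vector) \<noteq> 0 \<Longrightarrow> (id_cblinfun :: 'a bounded_operator) \<noteq> 0"
  by (metis id_cblinfun.rep_eq zero_cblinfun.rep_eq)

text \<open>Every rank-one operator factors through any given one, so a homomorphism that kills one
  of them kills them all, then the identity, and then everything; its range would be zero.\<close>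

lemma surjective_hom_rank_one_neq_0:
  fixes \<psi> :: "'x::complex_normed_vector bounded_operator \<Rightarrow> 'y::complex_normed_vector bounded_operator"
  assumes Y: "\<exists>y::'y. y \<noteq> 0"
    and sep: "separable_space (euclidean :: 'y topology)"
    and copies: "almost_disjoint_copies TYPE('x)"
    and hom: "algebra_hom \<psi>" and surj: "surj \<psi>"
    and xf: "cblinfun_apply f x \<noteq> 0"
  shows "\<psi> (rank_one x f) \<noteq> 0"
proof
  assume zero: "\<psi> (rank_one x f) = 0"
  note mult = hom_compose[OF hom]
  have "x \<noteq> 0" using xf by (auto simp: cblinfun_apply_zero)
  then obtain g :: "'x topological_dual" where g: "cblinfun_apply g x = 1" using functional_value_one by blast
  define z where "z = inverse (cblinfun_apply f x) *\<^sub>C x"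
  have z: "cblinfun_apply f z = 1" using xf by (simp add: z_def cblinfun_apply_scaleC scaleC_complex_def)
  have "\<psi> (rank_one u h) = 0" for u h
  proof -
    have "rank_one u h = rank_one u g o\<^sub>C (rank_one x f o\<^sub>C rank_one z h)"
      by (simp add: rank_one_compose_rank_one g z scaleC_one)
    then show ?thesis
      by (simp add: mult zero)
  qed
  then have "\<psi> id_cblinfun = 0" by (rule hom_vanishes_on_id[OF sep copies hom])
  then have "\<psi> A = 0" for A
    using mult[of A id_cblinfun] by simp
  then show False using surj Y id_cblinfun_neq_0 by (metis surjD)
qed

text \<open>Injectivity on the rank-one operators is enough for the argument of Eidelheit's theorem. The
  closed graph theorem makes any separate automatic continuity result unnecessary.\<close>

lemma surjective_hom_spatial:
  fixes \<psi> :: "'x::complex_banach bounded_operator \<Rightarrow> 'y::complex_banach bounded_operator"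
  assumes X: "\<exists>x::'x. x \<noteq> 0" and Y: "\<exists>y::'y. y \<noteq> 0"
    and sep: "separable_space (euclidean :: 'y topology)"
    and copies: "almost_disjoint_copies TYPE('x)"
    and hom: "algebra_hom \<psi>" and surj: "surj \<psi>"
  obtains T T' where "T o\<^sub>C T' = id_cblinfun" "T' o\<^sub>C T = id_cblinfun" "\<And>A. \<psi> A = T o\<^sub>C A o\<^sub>C T'"
proof -
  obtain x0 :: 'x where "x0 \<noteq> 0" using X by blast
  then obtain f0 :: "'x topological_dual" where f0: "cblinfun_apply f0 x0 = 1" using functional_value_one by blast
  define P where "P = rank_one x0 f0"
  have PP: "P o\<^sub>C P = P" by (simp add: P_def rank_one_compose_rank_one f0 scaleC_one)
  have "\<psi> P \<noteq> 0"
    unfolding P_def by (rule surjective_hom_rank_one_neq_0[OF Y sep copies hom surj]) (simp add: f0)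
  then obtain y1 where y1: "cblinfun_apply (\<psi> P) y1 \<noteq> 0"
    by (metis cblinfun_eqI zero_cblinfun.rep_eq)
  \<comment> \<open>Taking y0 in the range of the idempotent \<psi>(P) gives \<psi>(P) y0 = y0, that
    is t x0 = y0.\<close>
  define y0 where "y0 = cblinfun_apply (\<psi> P) y1"
  define t where "t = intertwiner \<psi> f0 y0"
  have tx0: "t x0 = y0"
    by (simp add: t_def intertwiner_def y0_def hom_apply_compose[OF hom] PP flip: P_def)
  have tA: "cblinfun_apply (\<psi> A) (t x) = t (cblinfun_apply A x)" for A x
    unfolding t_def by (rule intertwiner[OF hom])
  have tadd: "t (x + x') = t x + t x'" and tscale: "t (c *\<^sub>C x) = c *\<^sub>C t x" for x x' c
    by (simp_all add: t_def intertwiner_add[OF hom] intertwiner_scaleC[OF hom])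
  have y0: "y0 \<noteq> 0" using y1 by (simp add: y0_def)
  have t0: "x = 0" if "t x = 0" for x
    using intertwiner_eq_0[OF hom, of f0 y0 x0 x] that y0 tx0 by (simp add: t_def)
  \<comment> \<open>Some \<psi>(A) is the rank-one operator moving y0 to y, and the intertwining
    relation turns it into t (A x0) = y.\<close>
  have tsurj: "\<exists>x. t x = y" for y
  proof -
    obtain g :: "'y topological_dual" where g: "cblinfun_apply g y0 = 1" using functional_value_one[OF y0] by blast
    obtain A where "\<psi> A = rank_one y g" using surj by (metis surjD)
    then have "t (cblinfun_apply A x0) = y"
      using tA[of A x0] by (simp add: tx0 rank_one.rep_eq g scaleC_one)
    then show ?thesis by blast
  qed
  have "\<exists>T. cblinfun_apply T = t"
  proof (rule closed_graph_cblinfun[OF tadd tscale])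
    fix x :: "nat \<Rightarrow> 'x" and y assume x: "x \<longlonglongrightarrow> 0" and tx: "(\<lambda>n. t (x n)) \<longlonglongrightarrow> y"
    obtain x' where x': "y = t x'" using tsurj by metis
    \<comment> \<open>Each operator \<psi>(x0 \<otimes> f) is bounded on Y and sends t z to f(z) y0,
      so the convergence of t (x n) can be tested one functional at a time.\<close>
    have "cblinfun_apply f x' = 0" for f :: "'x topological_dual"
    proof -
      have eq: "cblinfun_apply (\<psi> (rank_one x0 f)) (t z) = cblinfun_apply f z *\<^sub>C y0" for z
        by (simp add: tA rank_one.rep_eq tscale tx0)
      have "(\<lambda>n. cblinfun_apply f (x n) *\<^sub>C y0) \<longlonglongrightarrow> cblinfun_apply f x' *\<^sub>C y0"
        unfolding eq[symmetric] x'[symmetric]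
        by (rule bounded_linear.tendsto[OF bounded_linear_cblinfun_apply tx])
      moreover have "(\<lambda>n. cblinfun_apply (rank_one y0 f) (x n)) \<longlonglongrightarrow> cblinfun_apply (rank_one y0 f) 0"
        by (rule bounded_linear.tendsto[OF bounded_linear_cblinfun_apply x])
      ultimately have "cblinfun_apply f x' *\<^sub>C y0 = 0"
        by (simp add: rank_one.rep_eq cblinfun_apply_zero scaleC_zero_left LIMSEQ_unique)
      then show ?thesis using y0 by (simp add: scaleC_eq_0_iff)
    qed
    then have "x' = 0" by (rule dual_separates_points)
    then show "y = 0" using tscale[of 0 0] by (simp add: x' scaleC_zero_left)
  qed
  then obtain T where T: "cblinfun_apply T = t" by blast
  obtain s where s: "\<And>y. t (s y) = y" using tsurj by metis
  have tinj: "x = x'" if "t x = t x'" for x x'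
    using t0[of "x - x'"] that unfolding T[symmetric] by (simp add: cblinfun_apply_diff)
  have "\<exists>T'. cblinfun_apply T' = s"
  proof (rule closed_graph_cblinfun)
    show "s (x + y) = s x + s y" for x y by (rule tinj) (simp add: s tadd)
    show "s (c *\<^sub>C x) = c *\<^sub>C s x" for c x by (rule tinj) (simp add: s tscale)
    fix y :: "nat \<Rightarrow> 'y" and x assume y: "y \<longlonglongrightarrow> 0" and sy: "(\<lambda>n. s (y n)) \<longlonglongrightarrow> x"
    have "(\<lambda>n. t (s (y n))) \<longlonglongrightarrow> t x"
      using bounded_linear.tendsto[OF bounded_linear_cblinfun_apply[of T] sy] by (simp add: T)
    then have "t x = 0" using y by (simp add: s LIMSEQ_unique)
    then show "x = 0" by (rule t0)
  qed
  then obtain T' where T': "cblinfun_apply T' = s" by blast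
  show thesis
  proof (rule that[of T T'])
    show "T o\<^sub>C T' = id_cblinfun" by (rule cblinfun_eqI) (simp add: cblinfun_rep_eqs id_cblinfun.rep_eq T T' s)
    show "T' o\<^sub>C T = id_cblinfun"
      by (rule cblinfun_eqI) (simp add: cblinfun_rep_eqs id_cblinfun.rep_eq T T' tinj s)
    show "\<psi> A = T o\<^sub>C A o\<^sub>C T'" for A
    proof (rule cblinfun_eqI)
      show "cblinfun_apply (\<psi> A) y = cblinfun_apply (T o\<^sub>C A o\<^sub>C T') y" for y
        using tA[of A "s y"] by (simp add: cblinfun_rep_eqs T T' s)
    qed
  qed
qed

section \<open>Transfer of reflexivity, and continuity of conjugation\<close>

lemma reflexive_spaceD:
  fixes F :: "'a::complex_normed_vector topological_dual topological_dual"
  assumes "reflexive_space TYPE('a)"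
  shows "\<exists>x. \<forall>f. cblinfun_apply F f = cblinfun_apply f x"
proof -
  obtain x :: 'a where "F = bidual_embedding x"
    using surjD[OF assms[unfolded reflexive_space_def]] by blast
  then show ?thesis by (intro exI[of _ x]) (simp add: bidual_embedding.rep_eq)
qed

text \<open>Pulling functionals back along T turns F into a functional on the dual of Y, which some
  y represents. As f = (f o T') o T, the vector T' y represents F.\<close>

lemma reflexive_isomorphic:
  fixes T :: "('x::complex_normed_vector, 'y::complex_normed_vector) cblinfun"
    and F :: "'x topological_dual topological_dual"
  assumes refl: "reflexive_space TYPE('y)" and T: "T' o\<^sub>C T = id_cblinfun"
  shows "\<exists>x::'x. \<forall>f. cblinfun_apply F f = cblinfun_apply f x"
proof -
  have "\<exists>G. cblinfun_apply G = (\<lambda>g :: 'y topological_dual. cblinfun_apply F (g o\<^sub>C T))"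
  proof (rule cblinfun_exists)
    show "cblinfun_apply F ((g + h) o\<^sub>C T) = cblinfun_apply F (g o\<^sub>C T) + cblinfun_apply F (h o\<^sub>C T)"
      for g h :: "'y topological_dual"
    proof -
      have "(g + h) o\<^sub>C T = (g o\<^sub>C T) + (h o\<^sub>C T)" by (rule cblinfun_eqI) (simp add: cblinfun_rep_eqs)
      then show ?thesis by (simp add: cblinfun_apply_add)
    qed
    show "cblinfun_apply F ((c *\<^sub>C g) o\<^sub>C T) = c *\<^sub>C cblinfun_apply F (g o\<^sub>C T)" for c and g :: "'y topological_dual"
    proof -
      have "(c *\<^sub>C g) o\<^sub>C T = c *\<^sub>C (g o\<^sub>C T)" by (rule cblinfun_eqI) (simp add: cblinfun_rep_eqs)
      then show ?thesis by (simp add: cblinfun_apply_scaleC)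
    qed
    show "norm (cblinfun_apply F (g o\<^sub>C T)) \<le> (norm F * norm T) * norm g" for g :: "'y topological_dual"
      using norm_cblinfun_apply[of F "g o\<^sub>C T"] mult_left_mono[OF norm_cblinfun_compose[of g T], of "norm F"]
      by (simp add: mult_ac)
  qed
  then obtain G where G: "cblinfun_apply G = (\<lambda>g :: 'y topological_dual. cblinfun_apply F (g o\<^sub>C T))" by blast
  obtain y where y: "\<And>g. cblinfun_apply G g = cblinfun_apply g y"
    using reflexive_spaceD[OF refl, of G] by blast
  have "cblinfun_apply F f = cblinfun_apply f (cblinfun_apply T' y)" for f
    using y[of "f o\<^sub>C T'"] by (simp add: G cblinfun_compose_assoc T) (simp add: cblinfun_rep_eqs)
  then show ?thesis by blast
qed

lemma continuous_on_conjugation: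
  fixes S :: "('a::complex_normed_vector, 'b::complex_normed_vector) cblinfun"
    and R :: "('c::complex_normed_vector, 'd::complex_normed_vector) cblinfun"
  shows "continuous_on UNIV (\<lambda>A. S o\<^sub>C A o\<^sub>C R)"
proof -
  have "bounded_linear (\<lambda>A. S o\<^sub>C A o\<^sub>C R)"
  proof (rule bounded_linear_intro[where K = "norm S * norm R"])
    show "S o\<^sub>C (A + B) o\<^sub>C R = (S o\<^sub>C A o\<^sub>C R) + (S o\<^sub>C B o\<^sub>C R)" for A B
      by (rule cblinfun_eqI) (simp add: cblinfun_rep_eqs cblinfun_apply_add)
    show "S o\<^sub>C (r *\<^sub>R A) o\<^sub>C R = r *\<^sub>R (S o\<^sub>C A o\<^sub>C R)" for r A
      by (rule cblinfun_eqI) (simp add: scaleR_scaleC cblinfun_rep_eqs cblinfun_apply_scaleC)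
    show "norm (S o\<^sub>C A o\<^sub>C R) \<le> norm A * (norm S * norm R)" for A
      using norm_cblinfun_compose[of "S o\<^sub>C A" R] mult_right_mono[OF norm_cblinfun_compose[of S A], of "norm R"]
      by (simp add: mult_ac)
  qed
  then show ?thesis by (intro linear_continuous_on)
qed

section \<open>The perturbed homomorphism\<close>

text \<open>The operator-theoretic argument, separated from the two classes of spaces: X enters
  through \<open>almost_disjoint_copies\<close>.\<close>

theorem perturbed_hom_is_iso:
  fixes \<psi> \<phi> :: "'x::complex_banach bounded_operator \<Rightarrow> 'y::complex_banach bounded_operator"
  assumes X: "\<exists>x::'x. x \<noteq> 0" and Y: "\<exists>y::'y. y \<noteq> 0"
    and sep: "separable_space (euclidean :: 'y topology)"
    and refl: "reflexive_space TYPE('y)"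
    and copies: "almost_disjoint_copies TYPE('x)"
    and hom: "algebra_hom \<psi>" "algebra_hom \<phi>"
    and surj: "surj \<psi>"
    and close: "\<And>A. A \<noteq> 0 \<Longrightarrow> norm (\<psi> A - \<phi> A) < norm A"
  shows "banach_algebra_iso \<phi>"
proof -
  note \<phi>_rules = hom_add[OF hom(2)] hom_scaleC[OF hom(2)] hom_apply_compose[OF hom(2)]
  obtain T T' where T: "T o\<^sub>C T' = id_cblinfun" "T' o\<^sub>C T = id_cblinfun" "\<And>A. \<psi> A = T o\<^sub>C A o\<^sub>C T'"
    using surjective_hom_spatial[OF X Y sep copies hom(1) surj] by blast
  have TT': "cblinfun_apply T (cblinfun_apply T' y) = y" for y
    using T(1) by (metis cblinfun_compose.rep_eq comp_apply id_cblinfun.rep_eq)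
  have T'T: "cblinfun_apply T' (cblinfun_apply T x) = x" for x
    using T(2) by (metis cblinfun_compose.rep_eq comp_apply id_cblinfun.rep_eq)
  \<comment> \<open>The product bounds \<psi>, and the summand 1 accounts for its distance from
    \<phi>.\<close>
  define K where "K = norm T * norm T' + 1"
  have "K \<ge> 0" by (simp add: K_def)
  have bounded: "norm (\<phi> A) \<le> K * norm A" for A
  proof (cases "A = 0")
    case False
    have "norm (\<psi> A) \<le> norm T * norm A * norm T'"
      unfolding T(3) using norm_cblinfun_compose[of "T o\<^sub>C A" T'] mult_right_mono[OF norm_cblinfun_compose[of T A], of "norm T'"]
      by simp
    moreover have "norm (\<phi> A) \<le> norm (\<psi> A) + norm (\<psi> A - \<phi> A)"
      by (metis norm_triangle_sub norm_minus_commute)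
    ultimately show ?thesis using close[OF False] by (simp add: K_def algebra_simps)
  qed (simp add: hom_zero[OF hom(2)])
  \<comment> \<open>Applied to p - q, to q - p and to 1 - S R: a vector that one of them does not
    shorten must vanish.\<close>
  have contraction: "y = 0" if "norm (B :: 'y bounded_operator) < 1" "norm y \<le> norm (cblinfun_apply B y)" for B y
  proof (rule ccontr)
    assume "y \<noteq> 0"
    have "norm y \<le> norm B * norm y" using norm_cblinfun_apply[of B y] that(2) by simp
    also have "\<dots> < 1 * norm y" using that(1) \<open>y \<noteq> 0\<close> by (intro mult_strict_right_mono) auto
    finally show False by simp
  qed

  obtain x1 :: 'x where "x1 \<noteq> 0" using X by blast
  \<comment> \<open>The normalisation gives f0 x0 = 1 and \<open>norm P \<le> 1\<close>, so that the
    hypothesis at P puts p and q at distance less than 1.\<close>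
  define x0 where "x0 = inverse (complex_of_real (norm x1)) *\<^sub>C x1"
  have x0: "norm x0 = 1" using \<open>x1 \<noteq> 0\<close> by (simp add: x0_def norm_scaleC norm_inverse)
  obtain f0 :: "'x topological_dual" where f0: "cblinfun_apply f0 x0 = 1" "norm f0 \<le> 1"
    using Hahn_Banach_norming[of x0] x0 by auto
  define P where "P = rank_one x0 f0"
  have PP: "P o\<^sub>C P = P" by (simp add: P_def rank_one_compose_rank_one f0 scaleC_one)
  have P0: "P \<noteq> 0"
  proof
    assume "P = 0"
    then have "cblinfun_apply P x0 = 0" by (simp add: zero_cblinfun.rep_eq)
    then show False using x0 by (auto simp: P_def rank_one.rep_eq f0 scaleC_one)
  qed
  define p where "p = \<psi> P"
  define q where "q = \<phi> P"
  have pq: "norm (p - q) < 1"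
    using close[OF P0] norm_rank_one_le[of x0 f0] x0 f0 by (simp add: p_def q_def P_def)
  have qp: "norm (q - p) < 1" using pq by (simp add: norm_minus_commute)
  define g where "g = f0 o\<^sub>C T'"
  define z where "z = cblinfun_apply T x0"
  have p: "cblinfun_apply p y = cblinfun_apply g y *\<^sub>C z" for y
    by (simp add: p_def T(3) P_def g_def z_def cblinfun_rep_eqs rank_one.rep_eq cblinfun_apply_scaleC)
  have pz: "cblinfun_apply p z = z"
    by (simp add: p g_def z_def cblinfun_rep_eqs T'T f0 scaleC_one)
  have z0: "z \<noteq> 0" using T'T[of x0] x0 by (auto simp: z_def cblinfun_apply_zero)
  define y0 where "y0 = cblinfun_apply q z"
  have qq: "cblinfun_apply q (cblinfun_apply q y) = cblinfun_apply q y" for y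
    by (simp add: q_def hom_apply_compose[OF hom(2)] PP)
  \<comment> \<open>If q killed z, then (p - q) z = z.\<close>
  have y0: "y0 \<noteq> 0"
    using contraction[OF pq, of z] z0 pz by (auto simp: y0_def cblinfun_rep_eqs)
  have qy0: "cblinfun_apply q y0 = y0" by (simp add: y0_def qq)
  \<comment> \<open>Such a u satisfies (q - p) u = u. Hence p is injective on the range of q, and
    the rank of q is at most that of p.\<close>
  have fixq: "u = 0" if "cblinfun_apply q u = u" "cblinfun_apply p u = 0" for u
    using contraction[OF qp, of u] that by (simp add: cblinfun_rep_eqs)
  then have gy0: "cblinfun_apply g y0 \<noteq> 0"
    using y0 qy0 by (auto simp: p scaleC_zero_left)
  \<comment> \<open>If q y is a multiple of y0, then applying g determines the factor. The error u
    of this guess is fixed by q and killed by p, hence zero.\<close>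
  define h where "h = inverse (cblinfun_apply g y0) *\<^sub>C (g o\<^sub>C q)"
  have q: "cblinfun_apply q y = cblinfun_apply h y *\<^sub>C y0" for y
  proof -
    define u where "u = cblinfun_apply q y - cblinfun_apply h y *\<^sub>C y0"
    have "u = 0"
    proof (rule fixq)
      show "cblinfun_apply q u = u" by (simp add: u_def cblinfun_apply_diff qq cblinfun_apply_scaleC qy0)
      show "cblinfun_apply p u = 0"
        using gy0 by (simp add: p u_def cblinfun_apply_diff cblinfun_apply_scaleC h_def cblinfun_rep_eqs
            scaleC_complex_def scaleC_scaleC field_simps)
    qed
    then show ?thesis by (simp add: u_def)
  qed
  have hy0: "cblinfun_apply h y0 = 1"
    using gy0 by (simp add: h_def cblinfun_rep_eqs scaleC_complex_def qy0)

  define s where "s = intertwiner \<phi> f0 y0"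
  have "\<exists>S. cblinfun_apply S = s"
  proof (rule cblinfun_exists)
    show "s (x + y) = s x + s y" "s (c *\<^sub>C x) = c *\<^sub>C s x" for x y c
      by (simp_all add: s_def intertwiner_add[OF hom(2)] intertwiner_scaleC[OF hom(2)])
    show "norm (s x) \<le> (K * norm f0 * norm y0) * norm x" for x
    proof -
      have "norm (s x) \<le> norm (\<phi> (rank_one x f0)) * norm y0"
        unfolding s_def intertwiner_def by (rule norm_cblinfun_apply)
      also have "\<dots> \<le> (K * (norm x * norm f0)) * norm y0"
        using bounded[of "rank_one x f0"] mult_left_mono[OF norm_rank_one_le[of x f0] \<open>K \<ge> 0\<close>]
        by (intro mult_right_mono) auto
      finally show ?thesis by (simp add: mult_ac)
    qed
  qed
  then obtain S where S: "cblinfun_apply S = s" by blast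
  have sA: "cblinfun_apply (\<phi> A) (s x) = s (cblinfun_apply A x)" for A x
    unfolding s_def by (rule intertwiner[OF hom(2)])
  have sx0: "s x0 = y0" using qy0 by (simp add: s_def intertwiner_def q_def P_def)
  have sscale: "s (c *\<^sub>C x) = c *\<^sub>C s x" for c x
    by (simp add: s_def intertwiner_scaleC[OF hom(2)])

  text \<open>The left inverse of \<open>S\<close> is the adjoint of \<open>f \<mapsto> h \<circ> \<phi> (x0 \<otimes> f)\<close>; this is where reflexivity is used.\<close>
  have "\<exists>x. \<forall>f. cblinfun_apply f x = cblinfun_apply h (cblinfun_apply (\<phi> (rank_one x0 f)) y)" for y
  proof -
    have "\<exists>F. cblinfun_apply F = (\<lambda>f. cblinfun_apply h (cblinfun_apply (\<phi> (rank_one x0 f)) y))"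
    proof (rule cblinfun_exists)
      show "cblinfun_apply h (cblinfun_apply (\<phi> (rank_one x0 (f + f'))) y) =
        cblinfun_apply h (cblinfun_apply (\<phi> (rank_one x0 f)) y) + cblinfun_apply h (cblinfun_apply (\<phi> (rank_one x0 f')) y)" for f f'
        by (simp add: rank_one_add_right \<phi>_rules cblinfun_rep_eqs cblinfun_apply_add)
      show "cblinfun_apply h (cblinfun_apply (\<phi> (rank_one x0 (c *\<^sub>C f))) y) =
        c *\<^sub>C cblinfun_apply h (cblinfun_apply (\<phi> (rank_one x0 f)) y)" for c f
        by (simp add: rank_one_scaleC_right \<phi>_rules cblinfun_rep_eqs cblinfun_apply_scaleC)
      show "norm (cblinfun_apply h (cblinfun_apply (\<phi> (rank_one x0 f)) y)) \<le> (norm h * (K * norm y)) * norm f" for f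
      proof -
        have "norm (cblinfun_apply h (cblinfun_apply (\<phi> (rank_one x0 f)) y))
            \<le> norm h * norm (cblinfun_apply (\<phi> (rank_one x0 f)) y)"
          by (rule norm_cblinfun_apply)
        also have "\<dots> \<le> norm h * (norm (\<phi> (rank_one x0 f)) * norm y)"
          by (intro mult_left_mono norm_cblinfun_apply) auto
        also have "\<dots> \<le> norm h * ((K * norm f) * norm y)"
          using bounded[of "rank_one x0 f"] mult_left_mono[OF norm_rank_one_le[of x0 f] \<open>K \<ge> 0\<close>] x0
          by (intro mult_left_mono mult_right_mono) auto
        finally show ?thesis by (simp add: mult_ac)
      qed
    qed
    then obtain F where "cblinfun_apply F = (\<lambda>f. cblinfun_apply h (cblinfun_apply (\<phi> (rank_one x0 f)) y))" by blast
    with reflexive_isomorphic[OF refl T(2), of F] show ?thesis by metis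
  qed
  then obtain r where r: "\<And>y f. cblinfun_apply f (r y) = cblinfun_apply h (cblinfun_apply (\<phi> (rank_one x0 f)) y)"
    by metis
  have dual_eqI: "x = x'" if "\<And>f :: 'x topological_dual. cblinfun_apply f x = cblinfun_apply f x'" for x x'
    using dual_separates_points[of "x - x'"] that by (simp add: cblinfun_apply_diff)
  have "\<exists>R. cblinfun_apply R = r"
  proof (rule cblinfun_exists)
    show "r (y + y') = r y + r y'" for y y' by (rule dual_eqI) (simp add: r cblinfun_apply_add)
    show "r (c *\<^sub>C y) = c *\<^sub>C r y" for c y by (rule dual_eqI) (simp add: r cblinfun_apply_scaleC)
    show "norm (r y) \<le> (norm h * K) * norm y" for y
    proof -
      obtain f :: "'x topological_dual" where f: "cblinfun_apply f (r y) = complex_of_real (norm (r y))" "norm f \<le> 1"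
        using Hahn_Banach_norming by blast
      have "norm (r y) = cmod (cblinfun_apply h (cblinfun_apply (\<phi> (rank_one x0 f)) y))"
        using f(1) by (simp flip: r)
      also have "\<dots> \<le> norm h * norm (cblinfun_apply (\<phi> (rank_one x0 f)) y)"
        by (rule norm_cblinfun_apply)
      also have "\<dots> \<le> norm h * (norm (\<phi> (rank_one x0 f)) * norm y)"
        by (intro mult_left_mono norm_cblinfun_apply) auto
      also have "\<dots> \<le> norm h * (K * norm y)"
      proof -
        have "norm (rank_one x0 f) \<le> 1" using norm_rank_one_le[of x0 f] x0 f(2) by simp
        then have "norm (\<phi> (rank_one x0 f)) \<le> K"
          using bounded[of "rank_one x0 f"] mult_left_mono[of "norm (rank_one x0 f)" 1 K] \<open>K \<ge> 0\<close> by simp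
        then show ?thesis by (intro mult_left_mono mult_right_mono) auto
      qed
      finally show ?thesis by (simp add: mult_ac)
    qed
  qed
  then obtain R where R: "cblinfun_apply R = r" by blast
  \<comment> \<open>Tested on f: \<phi>(x0 \<otimes> f) maps s x to f(x) y0, and h y0 = 1.\<close>
  have rs: "r (s x) = x" for x
    by (rule dual_eqI) (simp add: r sA rank_one.rep_eq sscale sx0 cblinfun_apply_scaleC hy0 scaleC_complex_def)
  have rA: "r (cblinfun_apply (\<phi> A) y) = cblinfun_apply A (r y)" for A y
  proof (rule dual_eqI)
    fix f :: "'x topological_dual"
    have "cblinfun_apply f (cblinfun_apply A (r y)) = cblinfun_apply (f o\<^sub>C A) (r y)"
      by (simp add: cblinfun_rep_eqs)
    then show "cblinfun_apply f (r (cblinfun_apply (\<phi> A) y)) = cblinfun_apply f (cblinfun_apply A (r y))"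
      by (simp only: r \<phi>_rules rank_one_compose)
  qed

  define \<theta> where "\<theta> A = \<phi> A - (S o\<^sub>C A o\<^sub>C R)" for A
  have sdiff: "s (x - y) = s x - s y" for x y unfolding S[symmetric] by (rule cblinfun_apply_diff)
  have s0: "s 0 = 0" using sdiff[of 0 0] by simp
  have sadd: "s (x + y) = s x + s y" for x y unfolding S[symmetric] by (rule cblinfun_apply_add)
  have rdiff: "r (x - y) = r x - r y" for x y unfolding R[symmetric] by (rule cblinfun_apply_diff)
  have \<theta>: "cblinfun_apply (\<theta> A) y = cblinfun_apply (\<phi> A) y - s (cblinfun_apply A (r y))" for A y
    by (simp add: \<theta>_def cblinfun_rep_eqs S R)
  \<comment> \<open>Multiplicativity: since R S = 1 and both maps intertwine, \<phi>(A) S B R, S A R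
    \<phi>(B) and S A R S B R all equal S A B R, so the product of the differences is \<phi>(A B) -
    S A B R.\<close>
  have "algebra_hom \<theta>"
    unfolding algebra_hom_def
  proof (intro conjI allI)
    show "\<theta> (A + B) = \<theta> A + \<theta> B" for A B
      by (rule cblinfun_eqI) (simp add: \<theta> \<phi>_rules cblinfun_rep_eqs sadd)
    show "\<theta> (c *\<^sub>C A) = c *\<^sub>C \<theta> A" for c A
      by (rule cblinfun_eqI) (simp add: \<theta> \<phi>_rules cblinfun_rep_eqs sscale scaleC_diff_right)
    show "\<theta> (A o\<^sub>C B) = \<theta> A o\<^sub>C \<theta> B" for A B
      by (rule cblinfun_eqI)
        (simp add: \<theta> hom_compose[OF hom(2)] cblinfun_rep_eqs cblinfun_apply_diff sA rdiff rA rs)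
  qed
  moreover have "\<theta> (rank_one x f) = 0" for x f
  proof (rule cblinfun_eqI)
    fix y
    \<comment> \<open>Factoring through x0 puts \<phi>(x0 \<otimes> f) y into the range of q, the
      line through y0, with coefficient f (r y) by the choice of r. Applying \<phi>(x \<otimes> f0)
      replaces y0 by s x.\<close>
    have split: "rank_one x' f = rank_one x' f0 o\<^sub>C rank_one x0 f" for x'
      by (simp add: rank_one_compose_rank_one f0 scaleC_one)
    have "cblinfun_apply (\<phi> (rank_one x0 f)) y = cblinfun_apply q (cblinfun_apply (\<phi> (rank_one x0 f)) y)"
      by (simp add: q_def P_def \<phi>_rules flip: split)
    also have "\<dots> = cblinfun_apply f (r y) *\<^sub>C y0" by (simp add: q r)
    finally have "cblinfun_apply (\<phi> (rank_one x f)) y = cblinfun_apply f (r y) *\<^sub>C s x"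
      by (subst split)
        (simp add: s_def intertwiner_def cblinfun_apply_scaleC flip: hom_apply_compose[OF hom(2)])
    then show "cblinfun_apply (\<theta> (rank_one x f)) y = cblinfun_apply 0 y"
      by (simp add: \<theta> rank_one.rep_eq sscale zero_cblinfun.rep_eq)
  qed
  ultimately have "\<theta> id_cblinfun = 0"
    by (rule hom_vanishes_on_id[OF sep copies])
  then have id: "cblinfun_apply (\<phi> id_cblinfun) y = s (r y)" for y
    using \<theta>[of id_cblinfun y] by (simp add: zero_cblinfun.rep_eq id_cblinfun.rep_eq)
  have sr: "s (r y) = y" for y
  proof -
    define B :: "'y bounded_operator" where "B = \<psi> id_cblinfun - \<phi> id_cblinfun"
    have "norm (id_cblinfun :: 'x bounded_operator) \<le> 1"
      by (rule norm_cblinfun_bound) (simp_all add: id_cblinfun.rep_eq)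
    then have "norm B < 1"
      using close[of id_cblinfun] id_cblinfun_neq_0[OF \<open>x1 \<noteq> 0\<close>] by (simp add: B_def)
    moreover have "cblinfun_apply B y = y - s (r y)" for y
      by (simp add: B_def T(3) T(1) cblinfun_rep_eqs id_cblinfun.rep_eq TT' id)
    ultimately have "y - s (r y) = 0"
      by (intro contraction[of B]) (simp_all add: rdiff rs sdiff s0)
    then show ?thesis by simp
  qed
  have \<phi>: "\<phi> A = S o\<^sub>C A o\<^sub>C R" for A
  proof (rule cblinfun_eqI)
    show "cblinfun_apply (\<phi> A) y = cblinfun_apply (S o\<^sub>C A o\<^sub>C R) y" for y
      using sA[of A "r y"] by (simp add: cblinfun_rep_eqs S R sr)
  qed
  have "homeomorphism UNIV UNIV \<phi> (\<lambda>B. R o\<^sub>C B o\<^sub>C S)"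
  proof (rule homeomorphismI)
    show "continuous_on UNIV \<phi>" "continuous_on UNIV (\<lambda>B. R o\<^sub>C B o\<^sub>C S)"
      unfolding \<phi>[abs_def] by (rule continuous_on_conjugation)+
    show "R o\<^sub>C \<phi> A o\<^sub>C S = A" for A
      unfolding \<phi> by (rule cblinfun_eqI) (simp add: cblinfun_rep_eqs S R rs)
    show "\<phi> (R o\<^sub>C B o\<^sub>C S) = B" for B
      unfolding \<phi> by (rule cblinfun_eqI) (simp add: cblinfun_rep_eqs S R sr)
  qed auto
  then show ?thesis using hom(2) unfolding banach_algebra_iso_def by blast
qed

section \<open>Unconditionally convergent series\<close>

text \<open>If the tails of the net of finite partial sums are not small, then blocks with large sums can
  be listed consecutively in a suitable permutation.\<close>

lemma permutable_series_small_tails: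
  fixes x :: "nat \<Rightarrow> 'a::banach"
  assumes perm: "\<And>\<pi>. bij \<pi> \<Longrightarrow> summable (\<lambda>n. x (\<pi> n))"
    and "\<epsilon> > 0"
  shows "\<exists>N. \<forall>G. finite G \<longrightarrow> G \<subseteq> {N..} \<longrightarrow> norm (sum x G) < \<epsilon>"
proof (rule ccontr)
  assume "\<not> ?thesis"
  then have "\<forall>N. \<exists>G. finite G \<and> G \<subseteq> {N..} \<and> \<epsilon> \<le> norm (sum x G)" by (meson not_less)
  then obtain G where G: "\<And>N. finite (G N)" "\<And>N. G N \<subseteq> {N..}" "\<And>N. \<epsilon> \<le> norm (sum x (G N))"
    unfolding choice_iff by blast
  \<comment> \<open>The sum of a list of naturals is at least each entry, so its successor is a
    threshold beyond everything listed so far.\<close>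
  define block where "block ys = sorted_list_of_set (G (Suc (sum_list ys)))" for ys :: "nat list"
  have set_block: "set (block ys) = G (Suc (sum_list ys))" for ys
    by (simp add: block_def G)
  have disj: "set ys \<inter> set (block ys) = {}" for ys
    using G(2)[of "Suc (sum_list ys)"] member_le_sum_list[of _ ys]
    unfolding set_block by (force simp: subset_eq)
  \<comment> \<open>Blocks alone may skip indices for ever; listing the missing ones up to k at
    stage k makes the permutation surjective.\<close>
  define fill where "fill k ys = filter (\<lambda>i. i \<notin> set ys \<and> i \<notin> set (block ys)) [0..<Suc k]" for k :: nat and ys :: "nat list"
  define L where "L = rec_nat [] (\<lambda>k ys. ys @ block ys @ fill k ys)"
  have L: "L 0 = []" "\<And>k. L (Suc k) = L k @ block (L k) @ fill k (L k)"
    by (simp_all add: L_def)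
  have block_ne: "block ys \<noteq> []" for ys
    using G(3)[of "Suc (sum_list ys)"] set_block[of ys] \<open>\<epsilon> > 0\<close> by auto
  have dist: "distinct (L k)" for k
  proof (induction k)
    case (Suc k)
    have "distinct (block (L k))" by (simp add: block_def)
    moreover have "distinct (fill k (L k))" by (simp add: fill_def)
    ultimately show ?case using Suc disj[of "L k"] by (auto simp: L fill_def)
  qed (simp add: L)
  have len: "k \<le> length (L k)" for k
  proof (induction k)
    case (Suc k)
    have "length (block (L k)) > 0" using block_ne by simp
    then show ?case using Suc.IH unfolding L length_append by linarith
  qed simp
  have prefix: "\<exists>zs. L (k + l) = L k @ zs" for k l
    by (induction l) (auto simp: L)
  have nth: "L k ! n = L l ! n" if "n < length (L k)" "n < length (L l)" for k l n
  proof -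
    obtain zs zs' where "L (k + l) = L k @ zs" "L (k + l) = L l @ zs'"
      using prefix[of k l] prefix[of l k] by (auto simp: add.commute)
    then show ?thesis using that by (metis nth_append)
  qed
  define \<pi> where "\<pi> n = L (Suc n) ! n" for n
  have \<pi>: "\<pi> n = L k ! n" if "n < length (L k)" for n k
    unfolding \<pi>_def using nth[of n "Suc n" k] len[of "Suc n"] that by simp
  have "bij \<pi>"
  proof (rule bijI)
    show "inj \<pi>"
    proof (rule injI)
      fix n m assume eq: "\<pi> n = \<pi> m"
      define k where "k = Suc (max n m)"
      have "n < length (L k)" "m < length (L k)" using len[of k] by (auto simp: k_def)
      then show "n = m" using eq \<pi> nth_eq_iff_index_eq[OF dist[of k]] by simp
    qed
    show "surj \<pi>"
      unfolding surj_def
    proof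
      fix i
      have "i \<in> set (L (Suc i))" by (auto simp: L fill_def)
      then show "\<exists>n. i = \<pi> n" using \<pi> by (metis in_set_conv_nth)
    qed
  qed
  then have "summable (\<lambda>n. x (\<pi> n))" by (rule perm)
  then obtain M where M: "\<And>m n. m \<ge> M \<Longrightarrow> norm (\<Sum>j=m..<n. x (\<pi> j)) < \<epsilon>"
    unfolding summable_Cauchy using \<open>\<epsilon> > 0\<close> by metis
  \<comment> \<open>The block appended to \<open>L M\<close> occupies consecutive positions from M
    or later, so the Cauchy criterion makes its sum smaller than \<epsilon>, against its
    choice.\<close>
  define ys where "ys = L M"
  define I where "I = {length ys..<length ys + length (block ys)}"
  have \<pi>I: "\<pi> j = block ys ! (j - length ys)" if "j \<in> I" for j
  proof -
    have "j < length (L (Suc M))" using that by (auto simp: I_def L ys_def)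
    from \<pi>[OF this] show ?thesis using that by (auto simp: I_def L ys_def nth_append)
  qed
  have "\<pi> ` I = G (Suc (sum_list ys))"
  proof -
    have "\<pi> ` I = (\<lambda>j. block ys ! (j - length ys)) ` I" using \<pi>I by (intro image_cong) auto
    also have "\<dots> = (!) (block ys) ` ((\<lambda>j. j - length ys) ` I)" by (simp add: image_image)
    also have "(\<lambda>j. j - length ys) ` I = {0..<length (block ys)}"
    proof -
      have "i \<in> (\<lambda>j. j - length ys) ` I" if "i < length (block ys)" for i
        using that by (intro image_eqI[of i _ "i + length ys"]) (auto simp: I_def)
      then show ?thesis by (auto simp: I_def)
    qed
    also have "(!) (block ys) ` {0..<length (block ys)} = set (block ys)"
      by (simp add: nth_image)
    finally show ?thesis by (simp add: set_block)
  qed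
  moreover have "(\<Sum>j\<in>I. x (\<pi> j)) = sum x (\<pi> ` I)"
    using \<open>bij \<pi>\<close> by (subst sum.reindex) (auto simp: bij_def intro: inj_on_subset)
  moreover have "norm (\<Sum>j\<in>I. x (\<pi> j)) < \<epsilon>"
    unfolding I_def by (rule M) (simp add: ys_def len)
  ultimately show False using G(3)[of "Suc (sum_list ys)"] by simp
qed

text \<open>As n \<le> \<sigma> n, finite stretches of the subseries are finite sums over a tail of
  the index set, which the previous lemma controls.\<close>

lemma permutable_series_subseries:
  fixes x :: "nat \<Rightarrow> 'a::banach"
  assumes perm: "\<And>\<pi>. bij \<pi> \<Longrightarrow> summable (\<lambda>n. x (\<pi> n))"
    and \<sigma>: "strict_mono \<sigma>"
  shows "summable (\<lambda>n. x (\<sigma> n))"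
  unfolding summable_Cauchy
proof (intro allI impI)
  fix \<epsilon> :: real assume "\<epsilon> > 0"
  from permutable_series_small_tails[of x, OF perm this]
  obtain N where N: "\<And>G. finite G \<Longrightarrow> G \<subseteq> {N..} \<Longrightarrow> norm (sum x G) < \<epsilon>" by blast
  have "norm (\<Sum>j=m..<n. x (\<sigma> j)) < \<epsilon>" if "m \<ge> N" for m n
  proof -
    have "(\<Sum>j=m..<n. x (\<sigma> j)) = sum x (\<sigma> ` {m..<n})"
      using \<sigma> by (subst sum.reindex) (auto intro: strict_mono_imp_inj_on inj_on_subset)
    moreover have "N \<le> \<sigma> j" if "j \<in> {m..<n}" for j
      using strict_mono_imp_increasing[OF \<sigma>, of j] that \<open>m \<ge> N\<close> by simp
    then have "\<sigma> ` {m..<n} \<subseteq> {N..}" by auto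
    ultimately show ?thesis using N[of "\<sigma> ` {m..<n}"] by simp
  qed
  then show "\<exists>N. \<forall>m\<ge>N. \<forall>n. norm (\<Sum>j=m..<n. x (\<sigma> j)) < \<epsilon>" by blast
qed

section \<open>Schauder bases\<close>

context
  fixes b :: "nat \<Rightarrow> 'a::complex_banach"
  assumes basis: "schauder_basis b"
begin

definition coord :: "'a \<Rightarrow> nat \<Rightarrow> complex" where
  "coord x = (THE a. (\<lambda>n. a n *\<^sub>C b n) sums x)"

lemma coord_sums: "(\<lambda>n. coord x n *\<^sub>C b n) sums x"
  unfolding coord_def by (rule theI'[of "\<lambda>a. (\<lambda>n. a n *\<^sub>C b n) sums x"]) (use basis in \<open>auto simp: schauder_basis_def\<close>)

lemma coord_eqI: "(\<lambda>n. a n *\<^sub>C b n) sums x \<Longrightarrow> coord x = a"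
  using coord_sums[of x] basis unfolding schauder_basis_def by blast

lemma coord_inject: "(\<And>n. coord x n = coord y n) \<Longrightarrow> x = y"
  using sums_unique2[OF coord_sums[of x]] coord_sums[of y] by simp

lemma coord_add: "coord (x + y) n = coord x n + coord y n"
proof -
  have "coord (x + y) = (\<lambda>n. coord x n + coord y n)"
    by (rule coord_eqI) (simp add: scaleC_add_left sums_add coord_sums)
  then show ?thesis by simp
qed

lemma coord_scaleC: "coord (c *\<^sub>C x) n = c * coord x n"
proof -
  have "coord (c *\<^sub>C x) = (\<lambda>n. c * coord x n)"
    by (rule coord_eqI)
      (use bounded_linear.sums[OF bounded_linear_scaleC_right coord_sums[of x], of c] in \<open>simp add: scaleC_scaleC\<close>)
  then show ?thesis by simp
qed

lemma coord_zero: "coord 0 n = 0"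
  using coord_scaleC[of 0 0 n] by (simp add: scaleC_zero_left)

lemma basis_neq_0: "b n \<noteq> 0"
proof
  assume "b n = 0"
  then have "(\<lambda>k. (if k = n then 1 else 0) *\<^sub>C b k) = (\<lambda>k. 0)"
    by (auto simp: scaleC_zero_left scaleC_zero_right)
  then have "coord 0 = (\<lambda>k. if k = n then 1 else 0)"
    by (intro coord_eqI) simp
  then show False using coord_zero[of n] by simp
qed

definition partial_sum :: "nat \<Rightarrow> 'a \<Rightarrow> 'a" where
  "partial_sum n x = (\<Sum>i<n. coord x i *\<^sub>C b i)"

text \<open>The standard renorming by partial sums. That it is dominated by the original norm is the
  core of Banach's theorem on the continuity of coordinates.\<close>

definition basis_norm :: "'a \<Rightarrow> real" where
  "basis_norm x = (SUP n. norm (partial_sum n x))"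

lemma partial_sum_tendsto: "(\<lambda>n. partial_sum n x) \<longlonglongrightarrow> x"
  using coord_sums[of x] by (simp add: sums_def partial_sum_def)

lemma partial_sum_add: "partial_sum n (x + y) = partial_sum n x + partial_sum n y"
  by (simp add: partial_sum_def coord_add scaleC_add_left sum.distrib)

lemma partial_sum_scaleC: "partial_sum n (c *\<^sub>C x) = c *\<^sub>C partial_sum n x"
  by (simp add: partial_sum_def coord_scaleC scaleC_sum_right scaleC_scaleC)

lemma bdd_above_partial_sums: "bdd_above (range (\<lambda>n. norm (partial_sum n x)))"
proof -
  have "bounded (range (\<lambda>n. partial_sum n x))"
    using partial_sum_tendsto convergent_imp_bounded by blast
  then show ?thesis by (auto simp: bounded_iff bdd_above_def)
qed

lemma partial_sum_le: "norm (partial_sum n x) \<le> basis_norm x"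
  unfolding basis_norm_def by (rule cSUP_upper[OF _ bdd_above_partial_sums]) simp

lemma basis_norm_le: "(\<And>n. norm (partial_sum n x) \<le> c) \<Longrightarrow> basis_norm x \<le> c"
  unfolding basis_norm_def by (rule cSUP_least) auto

lemma norm_le_basis_norm: "norm x \<le> basis_norm x"
  by (rule LIMSEQ_le_const2[OF tendsto_norm[OF partial_sum_tendsto[of x]]]) (use partial_sum_le in blast)

lemma norm_coord_le: "cmod (coord x n) * norm (b n) \<le> 2 * basis_norm x"
proof -
  have "norm (coord x n *\<^sub>C b n) = norm (partial_sum (Suc n) x - partial_sum n x)"
    by (simp add: partial_sum_def)
  also have "\<dots> \<le> basis_norm x + basis_norm x"
    by (intro order_trans[OF norm_triangle_ineq4] add_mono partial_sum_le)
  finally show ?thesis by (simp add: norm_scaleC)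
qed

text \<open>The coordinates of s ought to be the sums c n of those of the x k. That their series
  converges to s follows by taking the limit in n inside the sum over k, which Tannery's theorem
  permits with the majorant 2 basis_norm (x k); uniqueness of the expansion then applies.\<close>

lemma basis_norm_suminf:
  assumes x: "x sums s" and sm: "summable (\<lambda>k. basis_norm (x k))"
  shows "basis_norm s \<le> (\<Sum>k. basis_norm (x k))"
proof -
  have sc: "summable (\<lambda>k. coord (x k) n)" for n
  proof (rule summable_comparison_test'[where N = 0])
    show "summable (\<lambda>k. 2 * basis_norm (x k) / norm (b n))"
      by (intro summable_divide summable_mult sm)
    show "norm (coord (x k) n) \<le> 2 * basis_norm (x k) / norm (b n)" for k
      using norm_coord_le[of "x k" n] basis_neq_0[of n] by (simp add: field_simps)
  qed
  define c where "c n = (\<Sum>k. coord (x k) n)" for n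
  have bl: "bounded_linear (\<lambda>c. c *\<^sub>C b n)" for n
    by (rule bounded_linear_intro[where K = "norm (b n)"])
      (auto simp: scaleC_add_left scaleR_scaleC scaleC_scaleC norm_scaleC scaleC_complex_def)
  have part: "(\<lambda>k. partial_sum n (x k)) sums (\<Sum>i<n. c i *\<^sub>C b i)" for n
    unfolding partial_sum_def c_def
    by (intro sums_sum bounded_linear.sums[OF bl] summable_sums sc)
  have sn: "summable (\<lambda>k. norm (partial_sum n (x k)))" for n
    by (rule summable_comparison_test'[OF sm, where N = 0]) (simp add: partial_sum_le)
  have bound: "norm (\<Sum>i<n. c i *\<^sub>C b i) \<le> (\<Sum>k. basis_norm (x k))" for n
    using summable_norm[OF sn] suminf_le[OF partial_sum_le sn sm] sums_unique[OF part] by (metis order_trans)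
  have diff_le: "norm (partial_sum n (x k) - x k) \<le> 2 * basis_norm (x k)" for n k
    using norm_triangle_ineq4[of "partial_sum n (x k)" "x k"] partial_sum_le[of n "x k"] norm_le_basis_norm[of "x k"]
    by simp
  have "(\<lambda>n. \<Sum>k. norm (partial_sum n (x k) - x k)) \<longlonglongrightarrow> (\<Sum>k::nat. 0)"
  proof (rule conjunct2[OF conjunct2[OF tannerys_theorem[where M = "\<lambda>k. 2 * basis_norm (x k)"]]])
    show "(\<lambda>n. norm (partial_sum n (x k) - x k)) \<longlonglongrightarrow> 0" for k
      using partial_sum_tendsto by (intro tendsto_norm_zero LIM_zero)
    show "\<forall>\<^sub>F (k, n) in sequentially \<times>\<^sub>F sequentially.
        norm (norm (partial_sum n (x k) - x k)) \<le> 2 * basis_norm (x k)"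
      using diff_le by (intro always_eventually) auto
  qed (use sm in \<open>auto intro: summable_mult\<close>)
  then have lim0: "(\<lambda>n. \<Sum>k. norm (partial_sum n (x k) - x k)) \<longlonglongrightarrow> 0" by simp
  have "(\<lambda>n. (\<Sum>i<n. c i *\<^sub>C b i) - s) \<longlonglongrightarrow> 0"
  proof (rule Lim_null_comparison[OF always_eventually lim0], rule allI)
    fix n
    have sd: "(\<lambda>k. partial_sum n (x k) - x k) sums ((\<Sum>i<n. c i *\<^sub>C b i) - s)"
      by (intro sums_diff part x)
    have "summable (\<lambda>k. norm (partial_sum n (x k) - x k))"
      by (rule summable_comparison_test'[OF summable_mult[OF sm, of 2], where N = 0]) (simp add: diff_le)
    from summable_norm[OF this] show "norm ((\<Sum>i<n. c i *\<^sub>C b i) - s) \<le> (\<Sum>k. norm (partial_sum n (x k) - x k))"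
      using sums_unique[OF sd] by simp
  qed
  then have "(\<lambda>n. c n *\<^sub>C b n) sums s"
    unfolding sums_def by (rule LIM_zero_cancel)
  then have "partial_sum n s = (\<Sum>i<n. c i *\<^sub>C b i)" for n
    unfolding partial_sum_def by (simp add: coord_eqI)
  with bound show ?thesis by (intro basis_norm_le) simp
qed

lemma coord_bounded: "\<exists>f. cblinfun_apply f = (\<lambda>x. coord x n)"
proof -
  have "\<exists>K. \<forall>x. basis_norm x \<le> K * norm x"
  proof (rule Zabreiko)
    show nonneg: "0 \<le> basis_norm x" for x
      using norm_le_basis_norm[of x] norm_ge_zero order_trans by blast
    show "basis_norm (x + y) \<le> basis_norm x + basis_norm y" for x y
      by (intro basis_norm_le)
        (auto simp: partial_sum_add intro!: order_trans[OF norm_triangle_ineq] add_mono partial_sum_le)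
    have le: "basis_norm (r *\<^sub>R x) \<le> \<bar>r\<bar> * basis_norm x" for r x
      by (intro basis_norm_le) (auto simp: scaleR_scaleC partial_sum_scaleC norm_scaleC intro!: mult_left_mono partial_sum_le)
    show "basis_norm (r *\<^sub>R x) = \<bar>r\<bar> * basis_norm x" for r x
    proof (cases "r = 0")
      case True
      then show ?thesis using le[of r x] nonneg[of "r *\<^sub>R x"] by simp
    next
      case False
      then have "\<bar>r\<bar> * basis_norm x \<le> basis_norm (r *\<^sub>R x)"
        using le[of "inverse r" "r *\<^sub>R x"] by (simp add: field_simps)
      with le[of r x] show ?thesis by simp
    qed
  qed (fact basis_norm_suminf)
  then obtain K where K: "\<And>x. basis_norm x \<le> K * norm x" by blast
  show ?thesis
  proof (rule cblinfun_exists)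
    show "norm (coord x n) \<le> (2 * K / norm (b n)) * norm x" for x
      using norm_coord_le[of x n] K[of x] basis_neq_0[of n] by (simp add: field_simps)
  qed (simp_all add: coord_add coord_scaleC scaleC_complex_def)
qed

text \<open>\<open>g\<close> tells which input coordinate is copied to place n, \<open>None\<close>
  meaning 0, so spreading and compressing are treated at once. Coordinates are continuous, so
  pointwise convergence gives a bounded operator by the closed graph theorem.\<close>

lemma coord_operator:
  fixes g :: "nat \<Rightarrow> nat option"
  assumes "\<And>x. summable (\<lambda>n. (case g n of None \<Rightarrow> 0 | Some m \<Rightarrow> coord x m) *\<^sub>C b n)"
  obtains A :: "'a bounded_operator"
    where "\<And>x n. coord (cblinfun_apply A x) n = (case g n of None \<Rightarrow> 0 | Some m \<Rightarrow> coord x m)"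
proof -
  define w where "w x n = (case g n of None \<Rightarrow> 0 | Some m \<Rightarrow> coord x m)" for x n
  define L where "L x = (\<Sum>n. w x n *\<^sub>C b n)" for x
  have L: "coord (L x) n = w x n" for x n
    using coord_eqI[OF summable_sums[OF assms[of x, folded w_def]]] by (simp add: L_def)
  have "\<exists>A. cblinfun_apply A = L"
  proof (rule closed_graph_cblinfun)
    show "L (x + y) = L x + L y" for x y
      by (rule coord_inject) (simp add: L coord_add w_def split: option.split)
    show "L (c *\<^sub>C x) = c *\<^sub>C L x" for c x
      by (rule coord_inject) (simp add: L coord_scaleC w_def split: option.split)
    fix x :: "nat \<Rightarrow> 'a" and y assume x: "x \<longlonglongrightarrow> 0" and Lx: "(\<lambda>k. L (x k)) \<longlonglongrightarrow> y"
    have lim: "(\<lambda>k. coord (z k) n) \<longlonglongrightarrow> coord l n" if "z \<longlonglongrightarrow> l" for z l n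
    proof -
      obtain f where "cblinfun_apply f = (\<lambda>x. coord x n)" using coord_bounded by blast
      then show ?thesis using bounded_linear.tendsto[OF bounded_linear_cblinfun_apply[of f] that] by simp
    qed
    have "coord y n = 0" for n
    proof -
      have "(\<lambda>k. w (x k) n) \<longlonglongrightarrow> 0"
        using lim[OF x] by (cases "g n") (auto simp: w_def coord_zero)
      then show ?thesis
        using lim[OF Lx, of n] by (simp add: L LIMSEQ_unique)
    qed
    then show "y = 0" by (intro coord_inject) (simp add: coord_zero)
  qed
  then show thesis using that L unfolding w_def by metis
qed

end

section \<open>An almost disjoint family\<close>

text \<open>\<open>prefix_code a n\<close> codes the prefix of length \<open>n\<close> of \<open>a\<close>: it is a leading binary digit 1 followed by
  \<open>a 0, \<dots>, a (n - 1)\<close>.\<close>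

primrec prefix_code :: "(nat \<Rightarrow> bool) \<Rightarrow> nat \<Rightarrow> nat" where
  "prefix_code a 0 = 1"
| "prefix_code a (Suc n) = 2 * prefix_code a n + (if a n then 1 else 0)"

lemma prefix_code_pos: "0 < prefix_code a n"
  by (induction n) auto

lemma strict_mono_prefix_code: "strict_mono (prefix_code a)"
proof (rule strict_monoI_Suc)
  show "prefix_code a n < prefix_code a (Suc n)" for n
    using prefix_code_pos[of a n] by auto
qed

text \<open>Parity reveals the last digit and halving removes it; the leading 1 makes both codes run
  out of digits at the same moment.\<close>

lemma prefix_code_eqD: "prefix_code a n = prefix_code b m \<Longrightarrow> n = m \<and> (\<forall>i<n. a i = b i)"
proof (induction n arbitrary: m)
  case 0
  show ?case
  proof (cases m)
    case (Suc k)
    then have "2 \<le> prefix_code b m" using prefix_code_pos[of b k] by simp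
    with 0 show ?thesis by simp
  qed simp
next
  case (Suc n)
  show ?case
  proof (cases m)
    case 0
    then show ?thesis using Suc.prems prefix_code_pos[of a n] by auto
  next
    case [simp]: (Suc k)
    have eq: "2 * prefix_code a n + (if a n then 1 else 0) = 2 * prefix_code b k + (if b k then 1 else 0)"
      using Suc.prems by simp
    then have "prefix_code a n = prefix_code b k \<and> a n = b k"
      by (cases "a n"; cases "b k") (simp; presburger)+
    then show ?thesis using Suc.IH[of k] by (auto simp: less_Suc_eq)
  qed
qed

text \<open>\<open>d\<close> is a place where the sequences differ: a common code comes from a
  common prefix, and such a prefix cannot contain place d.\<close>

lemma prefix_code_almost_disjoint:
  assumes "a \<noteq> b"
  obtains d where "\<And>n m. prefix_code a n = prefix_code b m \<Longrightarrow> n = m \<and> n \<le> d"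
proof -
  obtain d where "a d \<noteq> b d" using assms by auto
  then show thesis using that[of d] prefix_code_eqD by (metis not_le)
qed

text \<open>\<open>U \<sigma>\<close> spreads the coordinates along \<sigma>, which equivalence with
  the subsequence permits. \<open>V \<sigma>\<close> reads them off along \<sigma>: unconditionality
  gives convergence of the subseries, and equivalence moves it back to b. For two codes, only the
  finitely many coordinates at common values survive.\<close>

lemma subsymmetric_almost_disjoint_copies:
  fixes b :: "nat \<Rightarrow> 'a::complex_banach"
  assumes "subsymmetric_basis b"
  shows "almost_disjoint_copies TYPE('a)"
proof -
  have uncond: "unconditional_basis b"
    and equiv: "\<And>a \<sigma>. strict_mono \<sigma> \<Longrightarrow> summable (\<lambda>n. a n *\<^sub>C b (\<sigma> n)) \<longleftrightarrow> summable (\<lambda>n. a n *\<^sub>C b n)"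
    using assms unfolding subsymmetric_basis_def equivalent_basic_sequences_def by blast+
  have basis: "schauder_basis b"
    and perm: "\<And>a \<pi>. summable (\<lambda>n. a n *\<^sub>C b n) \<Longrightarrow> bij \<pi> \<Longrightarrow> summable (\<lambda>n. a (\<pi> n) *\<^sub>C b (\<pi> n))"
    using uncond unfolding unconditional_basis_def by blast+
  note sums = coord_sums[OF basis] and inject = coord_inject[OF basis]
  let ?c = "coord b"
  define g where "g \<sigma> n = (if n \<in> range \<sigma> then Some (inv \<sigma> n) else None)" for \<sigma> :: "nat \<Rightarrow> nat" and n
  have "\<exists>A. \<forall>x n. ?c (cblinfun_apply A x) n = (case g \<sigma> n of None \<Rightarrow> 0 | Some m \<Rightarrow> ?c x m)"
    if \<sigma>: "strict_mono \<sigma>" for \<sigma>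
  proof -
    have "summable (\<lambda>n. (case g \<sigma> n of None \<Rightarrow> 0 | Some m \<Rightarrow> ?c x m) *\<^sub>C b n)" for x
    proof -
      have inj: "inj \<sigma>" using \<sigma> by (rule strict_mono_imp_inj_on)
      have "summable (\<lambda>n. ?c x n *\<^sub>C b (\<sigma> n))"
        using equiv[OF \<sigma>] sums_summable[OF sums] by blast
      then have "(\<lambda>n. (case g \<sigma> (\<sigma> n) of None \<Rightarrow> 0 | Some m \<Rightarrow> ?c x m) *\<^sub>C b (\<sigma> n)) sums (\<Sum>n. ?c x n *\<^sub>C b (\<sigma> n))"
        by (simp add: g_def inj summable_sums)
      then show ?thesis
        by (subst (asm) sums_mono_reindex[OF \<sigma>]) (auto simp: g_def scaleC_zero_left sums_summable)
    qed
    from coord_operator[OF basis this] show ?thesis by metis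
  qed
  then obtain U where U: "\<And>\<sigma> x n. strict_mono \<sigma> \<Longrightarrow>
      ?c (cblinfun_apply (U \<sigma>) x) n = (case g \<sigma> n of None \<Rightarrow> 0 | Some m \<Rightarrow> ?c x m)"
    by metis
  have "\<exists>A. \<forall>x n. ?c (cblinfun_apply A x) n = ?c x (\<sigma> n)" if \<sigma>: "strict_mono \<sigma>" for \<sigma>
  proof -
    have "summable (\<lambda>n. ?c x (\<sigma> n) *\<^sub>C b n)" for x
    proof -
      have "summable (\<lambda>n. ?c x (\<sigma> n) *\<^sub>C b (\<sigma> n))"
        by (rule permutable_series_subseries[of "\<lambda>n. ?c x n *\<^sub>C b n", OF _ \<sigma>])
          (rule perm[OF sums_summable[OF sums]])
      then show ?thesis using equiv[OF \<sigma>, of "\<lambda>n. ?c x (\<sigma> n)"] by simp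
    qed
    then have "summable (\<lambda>n. (case Some (\<sigma> n) of None \<Rightarrow> 0 | Some m \<Rightarrow> ?c x m) *\<^sub>C b n)" for x
      by simp
    from coord_operator[OF basis this] show ?thesis by (metis option.simps(5))
  qed
  then obtain V where V: "\<And>\<sigma> x n. strict_mono \<sigma> \<Longrightarrow> ?c (cblinfun_apply (V \<sigma>) x) n = ?c x (\<sigma> n)"
    by metis
  have VU: "?c (cblinfun_apply (V (prefix_code a) o\<^sub>C U (prefix_code a')) x) n =
      (case g (prefix_code a') (prefix_code a n) of None \<Rightarrow> 0 | Some m \<Rightarrow> ?c x m)" for a a' x n
    by (simp add: cblinfun_compose.rep_eq U V strict_mono_prefix_code)
  show ?thesis
    unfolding almost_disjoint_copies_def
  proof (rule exI[of _ "\<lambda>a. U (prefix_code a)"], rule exI[of _ "\<lambda>a. V (prefix_code a)"], intro conjI allI impI)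
    show "V (prefix_code a) o\<^sub>C U (prefix_code a) = id_cblinfun" for a
    proof (intro cblinfun_eqI inject)
      have "inj (prefix_code a)" using strict_mono_prefix_code by (rule strict_mono_imp_inj_on)
      then show "?c (cblinfun_apply (V (prefix_code a) o\<^sub>C U (prefix_code a)) x) n = ?c (cblinfun_apply id_cblinfun x) n" for x n
        by (simp add: VU g_def id_cblinfun.rep_eq)
    qed
    fix a a' :: "nat \<Rightarrow> bool" assume "a \<noteq> a'"
    then obtain d where d: "\<And>n m. prefix_code a n = prefix_code a' m \<Longrightarrow> n = m \<and> n \<le> d"
      using prefix_code_almost_disjoint by blast
    have "cblinfun_apply (V (prefix_code a) o\<^sub>C U (prefix_code a')) x =
        (\<Sum>i<Suc d. ?c (cblinfun_apply (V (prefix_code a) o\<^sub>C U (prefix_code a')) x) i *\<^sub>C b i)" (is "?y = _") for x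
    proof -
      have "?c ?y n = 0" if "n \<notin> {..<Suc d}" for n
        using d[of n] that by (auto simp: VU g_def)
      then have "(\<lambda>n. ?c ?y n *\<^sub>C b n) sums (\<Sum>i<Suc d. ?c ?y i *\<^sub>C b i)"
        by (intro sums_finite) (simp_all add: scaleC_zero_left)
      then show ?thesis using sums_unique2 sums by blast
    qed
    then show "finite_rank (V (prefix_code a) o\<^sub>C U (prefix_code a'))"
      unfolding finite_rank_def by metis
  qed
qed

section \<open>Operators on $L_p$ spaces\<close>

definition Lp_on :: "'m measure \<Rightarrow> real \<Rightarrow> ('m \<Rightarrow> complex) set" where
  "Lp_on M p = {f \<in> borel_measurable M. integrable M (\<lambda>t. cmod (f t) powr p)}"

definition Lp_norm :: "'m measure \<Rightarrow> real \<Rightarrow> ('m \<Rightarrow> complex) \<Rightarrow> real" where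
  "Lp_norm M p f = (LINT t|M. cmod (f t) powr p) powr (1 / p)"

text \<open>The condition in \<open>is_Lp_space\<close> with the measure space as a parameter, so
  that [0,1] can be exchanged for the coin-tossing space.\<close>

definition Lp_quotient :: "'m measure \<Rightarrow> real \<Rightarrow> (('m \<Rightarrow> complex) \<Rightarrow> 'a::complex_normed_vector) \<Rightarrow> bool" where
  "Lp_quotient M p q \<longleftrightarrow>
     (\<forall>f\<in>Lp_on M p. \<forall>g\<in>Lp_on M p. q (\<lambda>t. f t + g t) = q f + q g) \<and>
     (\<forall>c. \<forall>f\<in>Lp_on M p. q (\<lambda>t. c * f t) = c *\<^sub>C q f) \<and>
     (\<forall>f\<in>Lp_on M p. norm (q f) = Lp_norm M p f) \<and>
     q ` Lp_on M p = UNIV"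

lemma Lp_onD: "f \<in> Lp_on M p \<Longrightarrow> f \<in> borel_measurable M"
  "f \<in> Lp_on M p \<Longrightarrow> integrable M (\<lambda>t. cmod (f t) powr p)"
  by (auto simp: Lp_on_def)

lemma powr_add_le:
  fixes x y p :: real
  assumes "0 \<le> x" "0 \<le> y" "0 \<le> p"
  shows "(x + y) powr p \<le> 2 powr p * (x powr p + y powr p)"
proof -
  have "(x + y) powr p \<le> (2 * max x y) powr p"
    using assms by (intro powr_mono2) auto
  also have "\<dots> = 2 powr p * max x y powr p"
    using assms by (simp add: powr_mult)
  also have "\<dots> \<le> 2 powr p * (x powr p + y powr p)"
    by (intro mult_left_mono) (auto simp: max_def)
  finally show ?thesis .
qed

lemma Lp_on_add:
  assumes "0 \<le> p" and f: "f \<in> Lp_on M p" and g: "g \<in> Lp_on M p"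
  shows "(\<lambda>t. f t + g t) \<in> Lp_on M p"
  unfolding Lp_on_def
proof (intro CollectI conjI)
  note [measurable] = Lp_onD(1)[OF f] Lp_onD(1)[OF g]
  show "(\<lambda>t. f t + g t) \<in> borel_measurable M" by measurable
  show "integrable M (\<lambda>t. cmod (f t + g t) powr p)"
  proof (rule Bochner_Integration.integrable_bound)
    show "integrable M (\<lambda>t. 2 powr p * (cmod (f t) powr p + cmod (g t) powr p))"
      using Lp_onD(2)[OF f] Lp_onD(2)[OF g] by auto
    have "cmod (f t + g t) powr p \<le> 2 powr p * (cmod (f t) powr p + cmod (g t) powr p)" for t
      by (rule order_trans[OF powr_mono2[OF \<open>0 \<le> p\<close> _ norm_triangle_ineq] powr_add_le]) (use \<open>0 \<le> p\<close> in auto)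
    then show "AE t in M. norm (cmod (f t + g t) powr p) \<le> norm (2 powr p * (cmod (f t) powr p + cmod (g t) powr p))"
      by (intro AE_I2) (smt (verit) powr_ge_zero real_norm_def)
  qed measurable
qed

lemma Lp_on_mult:
  assumes f: "f \<in> Lp_on M p"
  shows "(\<lambda>t. c * f t) \<in> Lp_on M p"
  using f by (auto simp: Lp_on_def norm_mult powr_mult)

lemma Lp_on_bounded:
  assumes "finite_measure M" "f \<in> borel_measurable M" "0 \<le> p" "\<And>t. cmod (f t) \<le> B"
  shows "f \<in> Lp_on M p"
proof -
  interpret finite_measure M by fact
  have "integrable M (\<lambda>t. cmod (f t) powr p)"
    by (rule integrable_const_bound[where B = "B powr p"]) (use assms in \<open>auto intro!: powr_mono2\<close>)
  then show ?thesis using assms by (simp add: Lp_on_def)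
qed

context
  fixes M :: "'m measure" and p :: real and q :: "('m \<Rightarrow> complex) \<Rightarrow> 'a::complex_normed_vector"
  assumes p: "p > 1" and quotient: "Lp_quotient M p q"
begin

lemma quotient_add: "f \<in> Lp_on M p \<Longrightarrow> g \<in> Lp_on M p \<Longrightarrow> q (\<lambda>t. f t + g t) = q f + q g"
  and quotient_scaleC: "f \<in> Lp_on M p \<Longrightarrow> q (\<lambda>t. c * f t) = c *\<^sub>C q f"
  and norm_quotient: "f \<in> Lp_on M p \<Longrightarrow> norm (q f) = Lp_norm M p f"
  and quotient_surj: "\<exists>f\<in>Lp_on M p. q f = x"
proof -
  have "x \<in> q ` Lp_on M p" using quotient by (simp add: Lp_quotient_def)
  then show "\<exists>f\<in>Lp_on M p. q f = x" by blast
qed (use quotient in \<open>auto simp: Lp_quotient_def\<close>)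

lemma Lp_on_diff: "f \<in> Lp_on M p \<Longrightarrow> g \<in> Lp_on M p \<Longrightarrow> (\<lambda>t. f t - g t) \<in> Lp_on M p"
  using Lp_on_add[of p f M "\<lambda>t. (- 1) * g t"] Lp_on_mult[of g M p "- 1"] p by simp

lemma quotient_diff:
  assumes "f \<in> Lp_on M p" "g \<in> Lp_on M p"
  shows "q (\<lambda>t. f t - g t) = q f - q g"
  using quotient_add[OF Lp_on_diff[OF assms] assms(2)] by simp

lemma quotient_sum:
  assumes "finite I" "\<And>i. i \<in> I \<Longrightarrow> f i \<in> Lp_on M p"
  shows "(\<lambda>t. \<Sum>i\<in>I. c i * f i t) \<in> Lp_on M p \<and> q (\<lambda>t. \<Sum>i\<in>I. c i * f i t) = (\<Sum>i\<in>I. c i *\<^sub>C q (f i))"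
  using assms
proof (induction I rule: finite_induct)
  case empty
  have z: "(\<lambda>t. 0) \<in> Lp_on M p" by (simp add: Lp_on_def)
  then have "q (\<lambda>t. 0) = 0" using quotient_diff[OF z z] by simp
  then show ?case using z by simp
next
  case (insert j I)
  then show ?case
    using p by (simp add: Lp_on_add Lp_on_mult quotient_add quotient_scaleC)
qed

lemma quotient_cong_AE:
  assumes "f \<in> Lp_on M p" "g \<in> Lp_on M p" "AE t in M. f t = g t"
  shows "q f = q g"
proof -
  have "(LINT t|M. cmod (f t - g t) powr p) = (LINT t|M. 0)"
    using assms(3) Lp_onD(1)[OF assms(1)] Lp_onD(1)[OF assms(2)] by (intro integral_cong_AE) auto
  then have "norm (q (\<lambda>t. f t - g t)) = 0"
    using norm_quotient[OF Lp_on_diff[OF assms(1,2)]] by (simp add: Lp_norm_def)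
  then show ?thesis using quotient_diff[OF assms(1,2)] by simp
qed

text \<open>Linearity is asked for almost everywhere because averages are additive only where the
  integrals exist. Contraction makes the class of L f depend on that of f alone, so the operator can
  be read off a chosen representative.\<close>

lemma Lp_operator:
  assumes closed: "\<And>f. f \<in> Lp_on M p \<Longrightarrow> L f \<in> Lp_on M p"
    and add: "\<And>f g. f \<in> Lp_on M p \<Longrightarrow> g \<in> Lp_on M p \<Longrightarrow> AE t in M. L (\<lambda>t. f t + g t) t = L f t + L g t"
    and mult: "\<And>c f. f \<in> Lp_on M p \<Longrightarrow> AE t in M. L (\<lambda>t. c * f t) t = c * L f t"
    and contraction: "\<And>f. f \<in> Lp_on M p \<Longrightarrow> Lp_norm M p (L f) \<le> Lp_norm M p f"
  obtains A :: "'a bounded_operator" where "\<And>f. f \<in> Lp_on M p \<Longrightarrow> cblinfun_apply A (q f) = q (L f)"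
proof -
  have qadd: "q (L (\<lambda>t. f t + g t)) = q (L f) + q (L g)" if "f \<in> Lp_on M p" "g \<in> Lp_on M p" for f g
    using quotient_cong_AE[OF closed[OF Lp_on_add] Lp_on_add add] quotient_add closed that p by simp
  have qmult: "q (L (\<lambda>t. c * f t)) = c *\<^sub>C q (L f)" if "f \<in> Lp_on M p" for c f
    using quotient_cong_AE[OF closed[OF Lp_on_mult] Lp_on_mult mult] quotient_scaleC closed that by simp
  have qbound: "norm (q (L f)) \<le> norm (q f)" if "f \<in> Lp_on M p" for f
    using contraction closed norm_quotient that by simp
  have well_defined: "q (L f) = q (L g)" if "f \<in> Lp_on M p" "g \<in> Lp_on M p" "q f = q g" for f g
  proof -
    have "norm (q (L (\<lambda>t. f t - g t))) \<le> norm (q (\<lambda>t. f t - g t))"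
      using that by (intro qbound Lp_on_diff)
    also have "\<dots> = 0" using that by (simp add: quotient_diff)
    finally have "q (L (\<lambda>t. f t - g t)) = 0" by simp
    then show ?thesis using qadd[OF Lp_on_diff[OF that(1,2)] that(2)] by simp
  qed
  have "\<forall>x. \<exists>f. f \<in> Lp_on M p \<and> q f = x" using quotient_surj by blast
  then obtain rep where rep: "\<And>x. rep x \<in> Lp_on M p" "\<And>x. q (rep x) = x"
    unfolding choice_iff by blast
  have "\<exists>A. cblinfun_apply A = (\<lambda>x. q (L (rep x)))"
  proof (rule cblinfun_exists)
    show "q (L (rep (x + y))) = q (L (rep x)) + q (L (rep y))" for x y
      unfolding qadd[OF rep(1) rep(1), symmetric]
      by (rule well_defined) (use p in \<open>auto simp: rep quotient_add intro!: Lp_on_add\<close>)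
    show "q (L (rep (c *\<^sub>C x))) = c *\<^sub>C q (L (rep x))" for c x
      unfolding qmult[OF rep(1), symmetric]
      by (rule well_defined) (auto simp: rep quotient_scaleC intro!: Lp_on_mult)
    show "norm (q (L (rep x))) \<le> 1 * norm x" for x
      using qbound[OF rep(1)[of x]] by (simp add: rep)
  qed
  then obtain A where A: "cblinfun_apply A = (\<lambda>x. q (L (rep x)))" by blast
  show thesis
    by (rule that[of A]) (simp add: A well_defined[OF rep(1)] rep)
qed

end

text \<open>Jensen's inequality for the p-th power, by way of Young's. With v the mean of
  \<open>cmod (g t)\<close>, the second factor v powr (p - 1) has conjugate power v powr p, so
  integration yields v powr p on both sides and the factor 1 / p cancels.\<close>

lemma (in prob_space) integral_powr_le:
  fixes g :: "'a \<Rightarrow> complex"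
  assumes p: "p > 1" and g: "g \<in> Lp_on M p"
  shows "integrable M g" "cmod (integral\<^sup>L M g) powr p \<le> (LINT t|M. cmod (g t) powr p)"
proof -
  note [measurable] = Lp_onD(1)[OF g] and gp = Lp_onD(2)[OF g]
  show int: "integrable M g"
  proof (rule Bochner_Integration.integrable_bound)
    show "integrable M (\<lambda>t. 1 + cmod (g t) powr p)" using gp by simp
    have "cmod (g t) \<le> 1 + cmod (g t) powr p" for t
    proof (cases "cmod (g t) \<le> 1")
      case False
      then have "cmod (g t) powr 1 \<le> cmod (g t) powr p" using p by (intro powr_mono) auto
      then show ?thesis using False by simp
    qed (simp add: add_increasing2)
    then show "AE t in M. norm (g t) \<le> norm (1 + cmod (g t) powr p)"
      by (intro AE_I2) (smt (verit) powr_ge_zero real_norm_def)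
  qed measurable
  define v where "v = (LINT t|M. cmod (g t))"
  define r where "r = p / (p - 1)"
  have v: "0 \<le> v" by (simp add: v_def)
  have r: "r > 1" "1 / p + 1 / r = 1" "(p - 1) * r = p" using p by (auto simp: r_def field_simps)
  have young: "cmod (g t) * v powr (p - 1) \<le> cmod (g t) powr p / p + v powr p / r" for t
    using Youngs_inequality[OF p r(1,2), of "cmod (g t)" "v powr (p - 1)"] by (simp add: powr_powr r)
  have "v * v powr (p - 1) = (LINT t|M. cmod (g t) * v powr (p - 1))"
    by (simp add: v_def)
  also have "\<dots> \<le> (LINT t|M. cmod (g t) powr p / p + v powr p / r)"
    using int gp by (intro integral_mono young) auto
  also have "\<dots> = (LINT t|M. cmod (g t) powr p) / p + v powr p / r"
    using gp by (simp add: prob_space)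
  also have "v * v powr (p - 1) = v powr p"
    using v p by (cases "v = 0") (auto simp: powr_mult_base)
  finally have "v powr p * (1 - 1 / r) \<le> (LINT t|M. cmod (g t) powr p) / p" by (simp add: right_diff_distrib)
  also have "1 - 1 / r = 1 / p" using r(2) by simp
  finally have "v powr p \<le> (LINT t|M. cmod (g t) powr p)" using p by (simp add: field_simps)
  moreover have "cmod (integral\<^sup>L M g) powr p \<le> v powr p"
    unfolding v_def by (intro powr_mono2 integral_norm_bound) (use p in auto)
  ultimately show "cmod (integral\<^sup>L M g) powr p \<le> (LINT t|M. cmod (g t) powr p)" by simp
qed

lemma Lp_on_distr:
  assumes T: "T \<in> M \<rightarrow>\<^sub>M N" and f: "f \<in> borel_measurable N"
  shows "(\<lambda>t. f (T t)) \<in> Lp_on M p \<longleftrightarrow> f \<in> Lp_on (distr M N T) p"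
    and "Lp_norm M p (\<lambda>t. f (T t)) = Lp_norm (distr M N T) p f"
proof -
  note [measurable] = T f
  show "(\<lambda>t. f (T t)) \<in> Lp_on M p \<longleftrightarrow> f \<in> Lp_on (distr M N T) p"
    by (simp add: Lp_on_def integrable_distr_eq)
  show "Lp_norm M p (\<lambda>t. f (T t)) = Lp_norm (distr M N T) p f"
    by (simp add: Lp_norm_def integral_distr)
qed

section \<open>The coin-tossing space\<close>

abbreviation coin :: "bool measure" where
  "coin \<equiv> measure_pmf (pmf_of_set UNIV)"

definition coins :: "(nat \<Rightarrow> bool) measure" where
  "coins = (\<Pi>\<^sub>M i\<in>UNIV. coin)"

lemma space_coins [simp]: "space coins = UNIV"
  by (simp add: coins_def space_PiM PiE_UNIV_domain)

lemma emeasure_coin: "emeasure coin F = ennreal (card F / 2)"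
  by (simp add: emeasure_pmf_of_set)

interpretation coin_product: product_prob_space "\<lambda>_ :: nat. coin" UNIV
  by unfold_locales

interpretation coins: prob_space coins
  unfolding coins_def by (rule coin_product.P.prob_space_axioms)

lemma measurable_coins_component [measurable]: "(\<lambda>x. x i) \<in> coins \<rightarrow>\<^sub>M count_space UNIV"
  using measurable_component_singleton[of i UNIV "\<lambda>_. coin"] unfolding coins_def
  by (simp cong: measurable_cong_sets)

lemma measurable_coinsI:
  assumes "\<And>i. (\<lambda>t. f t i) \<in> M \<rightarrow>\<^sub>M count_space UNIV"
  shows "f \<in> M \<rightarrow>\<^sub>M coins"
  unfolding coins_def
  by (rule measurable_PiM_single') (use assms in \<open>auto simp: PiE_UNIV_domain cong: measurable_cong_sets\<close>)

lemma sets_coins_cylinder: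
  assumes "finite J"
  shows "{x. \<forall>j\<in>J. x j \<in> F j} \<in> sets coins"
proof -
  have "{x \<in> space coins. \<forall>j\<in>J. x j \<in> F j} \<in> sets coins" using assms by measurable
  then show ?thesis by simp
qed

lemma emeasure_coins_cylinder:
  assumes "finite J"
  shows "emeasure coins {x. \<forall>j\<in>J. x j \<in> F j} = (\<Prod>j\<in>J. emeasure coin (F j))"
  using coin_product.emeasure_PiM_Collect[of J F] assms by (simp add: coins_def space_PiM PiE_UNIV_domain)

lemma measure_eq_coinsI:
  assumes "sets M = sets coins"
    and "\<And>J F. finite J \<Longrightarrow> emeasure M {x. \<forall>j\<in>J. x j \<in> F j} = (\<Prod>j\<in>J. emeasure coin (F j))"
  shows "M = coins"
  unfolding coins_def
proof (rule coin_product.PiM_eq)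
  show "sets M = sets (\<Pi>\<^sub>M i\<in>UNIV. coin)" using assms(1) by (simp add: coins_def)
  fix J :: "nat set" and F :: "nat \<Rightarrow> bool set" assume "finite J"
  moreover have "prod_emb UNIV (\<lambda>_. coin) J (Pi\<^sub>E J F) = {x. \<forall>j\<in>J. x j \<in> F j}"
    by (auto simp: prod_emb_def PiE_UNIV_domain)
  ultimately show "emeasure M (prod_emb UNIV (\<lambda>_. coin) J (Pi\<^sub>E J F)) = (\<Prod>j\<in>J. emeasure coin (F j))"
    using assms(2) by simp
qed

lemma distr_coins_reindex:
  assumes "inj \<sigma>"
  shows "distr coins coins (\<lambda>x n. x (\<sigma> n)) = coins"
  using distr_PiM_reindex[of UNIV "\<lambda>_. coin" \<sigma> UNIV] assms prob_space_measure_pmf[of "pmf_of_set UNIV"]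
  by (simp add: coins_def restrict_UNIV)

text \<open>Letting x be a full sequence, whose entries on \<open>range \<sigma>\<close> are
  overwritten, allows averaging over the other coins without a second index set.\<close>

definition coin_merge :: "(nat \<Rightarrow> nat) \<Rightarrow> (nat \<Rightarrow> bool) \<Rightarrow> (nat \<Rightarrow> bool) \<Rightarrow> nat \<Rightarrow> bool" where
  "coin_merge \<sigma> s x n = (if n \<in> range \<sigma> then s (inv \<sigma> n) else x n)"

lemma measurable_coin_merge [measurable]:
  "(\<lambda>(s, x). coin_merge \<sigma> s x) \<in> coins \<Otimes>\<^sub>M coins \<rightarrow>\<^sub>M coins"
proof (rule measurable_coinsI)
  show "(\<lambda>t. (case t of (s, x) \<Rightarrow> coin_merge \<sigma> s x) i) \<in> coins \<Otimes>\<^sub>M coins \<rightarrow>\<^sub>M count_space UNIV" for i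
    by (cases "i \<in> range \<sigma>") (simp_all add: coin_merge_def split_beta)
qed

text \<open>A cylinder pulls back to a rectangle: its conditions at places in
  \<open>range \<sigma>\<close> fall on s, the others on x, and no place is counted twice since
  \<sigma> is injective.\<close>

lemma distr_coin_merge:
  assumes \<sigma>: "inj \<sigma>"
  shows "distr (coins \<Otimes>\<^sub>M coins) coins (\<lambda>(s, x). coin_merge \<sigma> s x) = coins"
proof (rule measure_eq_coinsI)
  fix J :: "nat set" and F :: "nat \<Rightarrow> bool set" assume J: "finite J"
  define A where "A = {s :: nat \<Rightarrow> bool. \<forall>i\<in>\<sigma> -` J. s i \<in> F (\<sigma> i)}"
  define B where "B = {x :: nat \<Rightarrow> bool. \<forall>j\<in>J - range \<sigma>. x j \<in> F j}"
  have fin: "finite (\<sigma> -` J)" using J \<sigma> by (rule finite_vimageI)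
  have [measurable]: "A \<in> sets coins" "B \<in> sets coins"
    unfolding A_def B_def using J fin by (intro sets_coins_cylinder; simp)+
  have "(\<lambda>(s, x). coin_merge \<sigma> s x) -` {x. \<forall>j\<in>J. x j \<in> F j} \<inter> space (coins \<Otimes>\<^sub>M coins) = A \<times> B"
    using \<sigma> by (auto simp: A_def B_def coin_merge_def space_pair_measure)
  then have "emeasure (distr (coins \<Otimes>\<^sub>M coins) coins (\<lambda>(s, x). coin_merge \<sigma> s x)) {x. \<forall>j\<in>J. x j \<in> F j}
      = emeasure coins A * emeasure coins B"
    using sets_coins_cylinder[OF J] by (simp add: emeasure_distr coins.emeasure_pair_measure_Times)
  also have "\<dots> = (\<Prod>i\<in>\<sigma> -` J. emeasure coin (F (\<sigma> i))) * (\<Prod>j\<in>J - range \<sigma>. emeasure coin (F j))"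
    unfolding A_def B_def using J fin by (simp add: emeasure_coins_cylinder)
  also have "(\<Prod>i\<in>\<sigma> -` J. emeasure coin (F (\<sigma> i))) = (\<Prod>j\<in>J \<inter> range \<sigma>. emeasure coin (F j))"
    using \<sigma> by (subst prod.reindex[symmetric, of \<sigma>, unfolded comp_def])
      (auto intro: inj_on_subset simp: image_vimage_eq)
  also have "\<dots> * (\<Prod>j\<in>J - range \<sigma>. emeasure coin (F j)) = (\<Prod>j\<in>J. emeasure coin (F j))"
    using prod.Int_Diff[OF J] by metis
  finally show "emeasure (distr (coins \<Otimes>\<^sub>M coins) coins (\<lambda>(s, x). coin_merge \<sigma> s x)) {x. \<forall>j\<in>J. x j \<in> F j}
      = (\<Prod>j\<in>J. emeasure coin (F j))" .
qed simp


lemma measurable_coins_reindex [measurable]: "(\<lambda>x n. x (\<sigma> n)) \<in> coins \<rightarrow>\<^sub>M coins"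
  by (rule measurable_coinsI) simp

text \<open>The conditional expectation given the coins along \<sigma>, written as a function of
  their values s.\<close>

definition coin_average :: "(nat \<Rightarrow> nat) \<Rightarrow> ((nat \<Rightarrow> bool) \<Rightarrow> complex) \<Rightarrow> (nat \<Rightarrow> bool) \<Rightarrow> complex" where
  "coin_average \<sigma> g s = (LINT x|coins. g (coin_merge \<sigma> s x))"

interpretation coin_pair: pair_prob_space coins coins
  by unfold_locales

context
  fixes \<sigma> :: "nat \<Rightarrow> nat" and p :: real
  assumes \<sigma>: "inj \<sigma>" and p: "p > 1"
begin

lemma reindex_Lp:
  assumes "f \<in> Lp_on coins p"
  shows "(\<lambda>x. f (\<lambda>n. x (\<sigma> n))) \<in> Lp_on coins p"
    and "Lp_norm coins p (\<lambda>x. f (\<lambda>n. x (\<sigma> n))) = Lp_norm coins p f"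
  using Lp_on_distr[OF measurable_coins_reindex[of \<sigma>] Lp_onD(1)[OF assms], where p = p]
    assms distr_coins_reindex[OF \<sigma>] by simp_all

text \<open>Merging preserves the measure, so h has the p-th moment of g on the product. Fubini's
  theorem and Jensen's inequality on the sections give the norm bound; the sections are integrable
  for almost every s.\<close>

lemma coin_average_Lp:
  assumes g: "g \<in> Lp_on coins p"
  shows "coin_average \<sigma> g \<in> Lp_on coins p"
    and "Lp_norm coins p (coin_average \<sigma> g) \<le> Lp_norm coins p g"
    and "AE s in coins. integrable coins (\<lambda>x. g (coin_merge \<sigma> s x))"
proof -
  note [measurable] = Lp_onD(1)[OF g]
  define h where "h z = g (coin_merge \<sigma> (fst z) (snd z))" for z
  have h_eq: "h = (\<lambda>z. g ((\<lambda>(s, x). coin_merge \<sigma> s x) z))" by (auto simp: h_def split_beta)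
  have hLp: "h \<in> Lp_on (coins \<Otimes>\<^sub>M coins) p"
    unfolding h_eq using Lp_on_distr(1)[OF measurable_coin_merge[of \<sigma>] Lp_onD(1)[OF g], where p = p]
      g distr_coin_merge[OF \<sigma>] by simp
  have hint: "(LINT z|(coins \<Otimes>\<^sub>M coins). cmod (h z) powr p) = (LINT x|coins. cmod (g x) powr p)"
    unfolding h_eq
    using integral_distr[OF measurable_coin_merge[of \<sigma>], of "\<lambda>x. cmod (g x) powr p"] distr_coin_merge[OF \<sigma>]
    by simp
  have sec: "(\<lambda>x. h (s, x)) \<in> borel_measurable coins" for s
    using Lp_onD(1)[OF hLp] by simp
  have AE: "AE s in coins. (\<lambda>x. h (s, x)) \<in> Lp_on coins p"
    using coin_pair.AE_integrable_fst'[OF Lp_onD(2)[OF hLp]] by (simp add: Lp_on_def sec)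
  then show "AE s in coins. integrable coins (\<lambda>x. g (coin_merge \<sigma> s x))"
    by eventually_elim (use coins.integral_powr_le(1)[OF p] in \<open>auto simp: h_def\<close>)
  have avg: "coin_average \<sigma> g s = (LINT x|coins. h (s, x))" for s
    by (simp add: coin_average_def h_def)
  have meas [measurable]: "coin_average \<sigma> g \<in> borel_measurable coins"
    unfolding avg[abs_def] using Lp_onD(1)[OF hLp] by measurable
  have int: "integrable coins (\<lambda>s. LINT x|coins. cmod (h (s, x)) powr p)"
    by (rule coin_pair.integrable_fst'[OF Lp_onD(2)[OF hLp]])
  have le: "AE s in coins. cmod (coin_average \<sigma> g s) powr p \<le> (LINT x|coins. cmod (h (s, x)) powr p)"
    using AE unfolding avg by eventually_elim (rule coins.integral_powr_le(2)[OF p])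
  have avg_int: "integrable coins (\<lambda>s. cmod (coin_average \<sigma> g s) powr p)"
    by (rule Bochner_Integration.integrable_bound[OF int]) (use le in \<open>auto elim!: eventually_mono\<close>)
  then show "coin_average \<sigma> g \<in> Lp_on coins p" by (simp add: Lp_on_def)
  have "(LINT s|coins. cmod (coin_average \<sigma> g s) powr p) \<le> (LINT s|coins. LINT x|coins. cmod (h (s, x)) powr p)"
    by (rule integral_mono_AE[OF avg_int int le])
  also have "\<dots> = (LINT x|coins. cmod (g x) powr p)"
    using coin_pair.integral_fst'[OF Lp_onD(2)[OF hLp]] hint by simp
  finally show "Lp_norm coins p (coin_average \<sigma> g) \<le> Lp_norm coins p g"
    unfolding Lp_norm_def using p by (intro powr_mono2) auto
qed

lemma coin_average_reindex: "coin_average \<sigma> (\<lambda>x. f (\<lambda>n. x (\<sigma> n))) = f"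
  using \<sigma> coins.prob_space by (intro ext) (simp add: coin_average_def coin_merge_def)

end

text \<open>An entry s n reaches the integrand only if \<sigma> n is in the range of \<tau>, and
  then n \<le> d; later entries may be reset to \<open>False\<close>.\<close>

lemma coin_average_reindex_finite:
  assumes "inj \<sigma>" and d: "\<And>n m. \<sigma> n = \<tau> m \<Longrightarrow> n = m \<and> n \<le> d"
  shows "coin_average \<sigma> (\<lambda>x. f (\<lambda>n. x (\<tau> n))) s = coin_average \<sigma> (\<lambda>x. f (\<lambda>n. x (\<tau> n))) (\<lambda>n. n \<le> d \<and> s n)"
proof -
  have "coin_merge \<sigma> s x (\<tau> m) = coin_merge \<sigma> (\<lambda>n. n \<le> d \<and> s n) x (\<tau> m)" for x m
  proof (cases "\<tau> m \<in> range \<sigma>")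
    case True
    then obtain n where n: "\<tau> m = \<sigma> n" by blast
    then have "n \<le> d" using d[of n m] by simp
    then show ?thesis using n \<open>inj \<sigma>\<close> by (simp add: coin_merge_def)
  qed (simp add: coin_merge_def)
  then show ?thesis by (simp add: coin_average_def)
qed

lemma Lp_coins_almost_disjoint_copies:
  fixes q :: "((nat \<Rightarrow> bool) \<Rightarrow> complex) \<Rightarrow> 'a::complex_normed_vector"
  assumes p: "p > 1" and quotient: "Lp_quotient coins p q"
  shows "almost_disjoint_copies TYPE('a)"
proof -
  let ?L = "Lp_on coins p"
  have "\<exists>A :: 'a bounded_operator. \<forall>f\<in>?L. cblinfun_apply A (q f) = q (\<lambda>x. f (\<lambda>n. x (\<sigma> n)))" if \<sigma>: "inj \<sigma>" for \<sigma>
    by (rule Lp_operator[OF p quotient, where L = "\<lambda>f x. f (\<lambda>n. x (\<sigma> n))"])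
      (use reindex_Lp[OF \<sigma> p] in auto)
  then obtain U :: "(nat \<Rightarrow> nat) \<Rightarrow> 'a bounded_operator"
    where U: "\<And>\<sigma> f. inj \<sigma> \<Longrightarrow> f \<in> ?L \<Longrightarrow> cblinfun_apply (U \<sigma>) (q f) = q (\<lambda>x. f (\<lambda>n. x (\<sigma> n)))"
    by metis
  have "\<exists>A :: 'a bounded_operator. \<forall>f\<in>?L. cblinfun_apply A (q f) = q (coin_average \<sigma> f)" if \<sigma>: "inj \<sigma>" for \<sigma>
  proof (rule Lp_operator[OF p quotient, where L = "coin_average \<sigma>"])
    note avg = coin_average_Lp[OF \<sigma> p]
    show "coin_average \<sigma> f \<in> ?L" "Lp_norm coins p (coin_average \<sigma> f) \<le> Lp_norm coins p f" if "f \<in> ?L" for f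
      using avg that by auto
    show "AE s in coins. coin_average \<sigma> (\<lambda>t. f t + g t) s = coin_average \<sigma> f s + coin_average \<sigma> g s"
      if "f \<in> ?L" "g \<in> ?L" for f g
      using avg(3)[OF that(1)] avg(3)[OF that(2)] by eventually_elim (simp add: coin_average_def)
    show "AE s in coins. coin_average \<sigma> (\<lambda>t. c * f t) s = c * coin_average \<sigma> f s" for c f
      by (simp add: coin_average_def)
  qed blast
  then obtain V :: "(nat \<Rightarrow> nat) \<Rightarrow> 'a bounded_operator"
    where V: "\<And>\<sigma> f. inj \<sigma> \<Longrightarrow> f \<in> ?L \<Longrightarrow> cblinfun_apply (V \<sigma>) (q f) = q (coin_average \<sigma> f)"
    by metis
  have inj: "inj (prefix_code a)" for a
    using strict_mono_prefix_code by (rule strict_mono_imp_inj_on)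
  have VU: "cblinfun_apply (V (prefix_code a) o\<^sub>C U (prefix_code a')) (q f) =
      q (coin_average (prefix_code a) (\<lambda>x. f (\<lambda>n. x (prefix_code a' n))))" if "f \<in> ?L" for f a a'
    using that reindex_Lp[OF inj p] by (simp add: cblinfun_compose.rep_eq U V inj)
  show ?thesis
    unfolding almost_disjoint_copies_def
  proof (rule exI[of _ "\<lambda>a. U (prefix_code a)"], rule exI[of _ "\<lambda>a. V (prefix_code a)"], intro conjI allI impI)
    show "V (prefix_code a) o\<^sub>C U (prefix_code a) = id_cblinfun" for a
    proof (rule cblinfun_eqI)
      fix x
      obtain f where "f \<in> ?L" "x = q f" using quotient_surj[OF p quotient, where x = x] by blast
      then show "cblinfun_apply (V (prefix_code a) o\<^sub>C U (prefix_code a)) x = cblinfun_apply id_cblinfun x"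
        by (simp add: VU coin_average_reindex[OF inj p] id_cblinfun.rep_eq)
    qed
    fix a a' :: "nat \<Rightarrow> bool" assume "a \<noteq> a'"
    then obtain d where d: "\<And>n m. prefix_code a n = prefix_code a' m \<Longrightarrow> n = m \<and> n \<le> d"
      using prefix_code_almost_disjoint by blast
    \<comment> \<open>\<open>tr\<close> forgets the coins after place d. The averaged function
      factors through it, so it is a combination of the indicators \<open>e i\<close> of the
      finitely many fibres, with its values at \<open>w i\<close> as coefficients.\<close>
    define tr where "tr s n = (n \<le> d \<and> s n)" for s :: "nat \<Rightarrow> bool" and n
    have fin: "finite (range tr)"
    proof (rule finite_subset)
      show "range tr \<subseteq> (\<lambda>D n. n \<in> D) ` Pow {..d}"
      proof safe
        fix s
        show "tr s \<in> (\<lambda>D n. n \<in> D) ` Pow {..d}"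
          by (rule image_eqI[where x = "{n. n \<le> d \<and> s n}"]) (auto simp: tr_def)
      qed
    qed simp
    then obtain w and N :: nat where w: "range tr = w ` {i. i < N}" "inj_on w {i. i < N}"
      using finite_imp_nat_seg_image_inj_on[OF fin] by blast
    define e where "e i s = (if tr s = w i then 1 else 0 :: complex)" for i s
    have e: "e i \<in> ?L" for i
    proof (rule Lp_on_bounded)
      show "e i \<in> borel_measurable coins"
      proof -
        have cyl: "{s \<in> space coins. \<forall>n\<in>{..d}. s n = w i n} \<in> sets coins" by measurable
        have "tr s = w i \<longleftrightarrow> (\<forall>n\<in>{..d}. s n = w i n) \<and> (\<forall>n>d. \<not> w i n)" for s
          unfolding fun_eq_iff tr_def by (metis atMost_iff not_le)
        \<comment> \<open>For i \<ge> N the sequence \<open>w i\<close> is arbitrary and may be true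
          beyond d; its fibre is then empty instead of a cylinder.\<close>
        then have eq: "{s \<in> space coins. tr s = w i} =
            (if \<forall>n>d. \<not> w i n then {s \<in> space coins. \<forall>n\<in>{..d}. s n = w i n} else {})"
          by simp
        have ev: "{s \<in> space coins. tr s = w i} \<in> sets coins"
          unfolding eq by (split if_split) (simp only: cyl sets.empty_sets simp_thms)
        show ?thesis unfolding e_def by (rule measurable_If[OF _ _ ev]) simp_all
      qed
      show "cmod (e i s) \<le> 1" for s by (simp add: e_def)
    qed (use p coins.finite_measure_axioms in auto)
    have "\<exists>c. cblinfun_apply (V (prefix_code a) o\<^sub>C U (prefix_code a')) x = (\<Sum>i<N. c i *\<^sub>C q (e i))" for x
    proof -
      obtain f where f: "f \<in> ?L" "x = q f" using quotient_surj[OF p quotient, where x = x] by blast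
      define F where "F = coin_average (prefix_code a) (\<lambda>x. f (\<lambda>n. x (prefix_code a' n)))"
      have "F s = (\<Sum>i<N. F (w i) * e i s)" for s
      proof -
        have "tr s \<in> w ` {i. i < N}" using w by blast
        then obtain j where j: "j < N" "tr s = w j" by blast
        have "(\<Sum>i<N. F (w i) * e i s) = (\<Sum>i<N. if i = j then F (w i) else 0)"
          using j w(2) by (intro sum.cong) (auto simp: e_def inj_on_def)
        also have "\<dots> = F (tr s)" using j by simp
        also have "\<dots> = F s"
          unfolding F_def tr_def[abs_def] by (rule coin_average_reindex_finite[OF inj d, symmetric])
        finally show ?thesis by simp
      qed
      then have "F = (\<lambda>s. \<Sum>i<N. F (w i) * e i s)" by (rule ext)
      then have "q F = q (\<lambda>s. \<Sum>i<N. F (w i) * e i s)" by (rule arg_cong)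
      also have "\<dots> = (\<Sum>i<N. F (w i) *\<^sub>C q (e i))"
        using quotient_sum[OF p quotient, of "{..<N}" e] e by simp
      finally show ?thesis using f by (intro exI[of _ "\<lambda>i. F (w i)"]) (simp add: VU F_def)
    qed
    then show "finite_rank (V (prefix_code a) o\<^sub>C U (prefix_code a'))"
      unfolding finite_rank_def by (intro exI[of _ N] exI[of _ "\<lambda>i. q (e i)"]) blast
  qed
qed


text \<open>Composition with a measure-preserving T keeps the seminorm. It stays onto because every
  measurable function agrees almost everywhere with one that factors through T.\<close>

lemma Lp_quotient_transfer:
  fixes q :: "('m \<Rightarrow> complex) \<Rightarrow> 'a::complex_normed_vector"
  assumes p: "p > 1" and quotient: "Lp_quotient M p q"
    and T: "T \<in> M \<rightarrow>\<^sub>M N" and distr: "distr M N T = N"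
    and surj: "\<And>f :: 'm \<Rightarrow> complex. f \<in> borel_measurable M \<Longrightarrow> \<exists>g\<in>borel_measurable N. AE t in M. f t = g (T t)"
  shows "Lp_quotient N p (\<lambda>g. q (\<lambda>t. g (T t)))"
proof -
  have Lp: "(\<lambda>t. g (T t)) \<in> Lp_on M p \<longleftrightarrow> g \<in> Lp_on N p" "Lp_norm M p (\<lambda>t. g (T t)) = Lp_norm N p g"
    if "g \<in> borel_measurable N" for g
    using Lp_on_distr[OF T that] by (simp_all add: distr)
  have "\<exists>g\<in>Lp_on N p. q (\<lambda>t. g (T t)) = x" for x
  proof -
    obtain f where f: "f \<in> Lp_on M p" "q f = x" using quotient_surj[OF p quotient, where x = x] by blast
    obtain g where g: "g \<in> borel_measurable N" "AE t in M. f t = g (T t)"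
      using surj[OF Lp_onD(1)[OF f(1)]] by blast
    have "(\<lambda>t. g (T t)) \<in> borel_measurable M" using T g(1) by simp
    moreover have "integrable M (\<lambda>t. cmod (g (T t)) powr p)"
      using Lp_onD(2)[OF f(1)] g T Lp_onD(1)[OF f(1)]
      by (subst integrable_cong_AE[of _ _ "\<lambda>t. cmod (f t) powr p"]) auto
    ultimately have gT: "(\<lambda>t. g (T t)) \<in> Lp_on M p" by (simp add: Lp_on_def)
    then have "q (\<lambda>t. g (T t)) = x"
      using quotient_cong_AE[OF p quotient f(1) gT g(2)] f(2) by simp
    then show ?thesis using gT Lp(1)[OF g(1)] by blast
  qed
  then have "x \<in> (\<lambda>g. q (\<lambda>t. g (T t))) ` Lp_on N p" for x
    unfolding image_iff by metis
  then have "(\<lambda>g. q (\<lambda>t. g (T t))) ` Lp_on N p = UNIV" by blast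
  moreover have LpD: "(\<lambda>t. g (T t)) \<in> Lp_on M p" "Lp_norm M p (\<lambda>t. g (T t)) = Lp_norm N p g"
    if "g \<in> Lp_on N p" for g
    using Lp[OF Lp_onD(1)[OF that]] that by simp_all
  ultimately show ?thesis
    by (simp add: Lp_quotient_def quotient_add[OF p quotient] quotient_scaleC[OF p quotient]
        norm_quotient[OF p quotient])
qed

section \<open>Binary digits\<close>

text \<open>Digit n has weight 1 / 2^(n+1), so the digit of weight 1/2 has index 0.\<close>

definition binary_digits :: "real \<Rightarrow> nat \<Rightarrow> bool" where
  "binary_digits t n = odd \<lfloor>t * 2 ^ Suc n\<rfloor>"

lemma floor_double_div: "\<lfloor>t * 2 ^ Suc n\<rfloor> div 2 = \<lfloor>t * 2 ^ n :: real\<rfloor>"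
  using floor_divide_real_eq_div[of 2 "t * 2 ^ Suc n"] by simp

lemma emeasure_floor:
  assumes "finite K"
  shows "{t :: real. \<lfloor>t * 2 ^ n\<rfloor> \<in> K} \<in> sets borel"
    and "emeasure lborel {t :: real. \<lfloor>t * 2 ^ n\<rfloor> \<in> K} = ennreal (card K / 2 ^ n)"
proof -
  define I where "I k = {real_of_int k / 2 ^ n..<(real_of_int k + 1) / 2 ^ n}" for k :: int
  have I: "t \<in> I k \<longleftrightarrow> \<lfloor>t * 2 ^ n\<rfloor> = k" for t k
    by (simp add: I_def floor_eq_iff field_simps)
  then have eq: "{t :: real. \<lfloor>t * 2 ^ n\<rfloor> \<in> K} = (\<Union>k\<in>K. I k)" by auto
  show "{t :: real. \<lfloor>t * 2 ^ n\<rfloor> \<in> K} \<in> sets borel"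
    unfolding eq by (rule sets.finite_UN[OF assms]) (simp add: I_def)
  have len: "emeasure lborel (I k) = ennreal (1 / 2 ^ n)" for k
    by (simp add: I_def divide_right_mono flip: diff_divide_distrib)
  have "emeasure lborel (\<Union>k\<in>K. I k) = (\<Sum>k\<in>K. emeasure lborel (I k))"
  proof (rule sum_emeasure[symmetric])
    show "I ` K \<subseteq> sets lborel" by (auto simp: I_def)
    show "disjoint_family_on I K" using I by (auto simp: disjoint_family_on_def)
  qed fact
  also have "\<dots> = ennreal (card K / 2 ^ n)"
    by (simp add: len ennreal_of_nat_eq_real_of_nat flip: ennreal_mult)
  finally show "emeasure lborel {t :: real. \<lfloor>t * 2 ^ n\<rfloor> \<in> K} = ennreal (card K / 2 ^ n)" by (simp only: eq)
qed

text \<open>On [0,1) the first n digits are those of the integer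
  \<open>\<lfloor>t * 2 ^ n\<rfloor>\<close>, so the event is a union of dyadic intervals indexed by
  a finite set K. A further digit refines k to 2k or 2k + 1 and multiplies the size of K by the
  number of allowed digits.\<close>

lemma emeasure_binary_digits:
  fixes F :: "nat \<Rightarrow> bool set"
  defines "A \<equiv> \<lambda>n. {t. 0 \<le> t \<and> t < 1 \<and> (\<forall>j<n. binary_digits t j \<in> F j)}"
  shows "A n \<in> sets borel" and "emeasure lborel (A n) = (\<Prod>j<n. emeasure coin (F j))"
proof -
  have "\<exists>K. finite K \<and> card K = (\<Prod>j<n. card (F j)) \<and> A n = {t. \<lfloor>t * 2 ^ n\<rfloor> \<in> K}"
  proof (induction n)
    case 0
    have "A 0 = {t. \<lfloor>t * 2 ^ 0\<rfloor> \<in> {0}}" by (auto simp: A_def floor_eq_iff)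
    then show ?case by (intro exI[of _ "{0}"]) simp
  next
    case (Suc n)
    then obtain K where K: "finite K" "card K = (\<Prod>j<n. card (F j))" "A n = {t. \<lfloor>t * 2 ^ n\<rfloor> \<in> K}"
      by blast
    define g :: "int \<times> bool \<Rightarrow> int" where "g = (\<lambda>(k, c). 2 * k + of_bool c)"
    have "(g z div 2, odd (g z)) = z" for z
      by (cases z; cases "snd z") (auto simp: g_def)
    then have inj: "inj_on g (K \<times> F n)"
      by (intro inj_on_inverseI[where g = "\<lambda>k. (k div 2, odd k)"])
    have g: "k \<in> g ` (K \<times> F n) \<longleftrightarrow> k div 2 \<in> K \<and> odd k \<in> F n" for k
    proof
      assume "k \<in> g ` (K \<times> F n)"
      then show "k div 2 \<in> K \<and> odd k \<in> F n" by (auto simp: g_def of_bool_def split: if_splits)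
    next
      assume "k div 2 \<in> K \<and> odd k \<in> F n"
      moreover have "k = g (k div 2, odd k)" by (simp add: g_def of_bool_def)
      ultimately show "k \<in> g ` (K \<times> F n)" by blast
    qed
    have "A (Suc n) = {t. \<lfloor>t * 2 ^ Suc n\<rfloor> \<in> g ` (K \<times> F n)}"
    proof -
      have "A (Suc n) = {t \<in> A n. binary_digits t n \<in> F n}"
        by (auto simp: A_def less_Suc_eq)
      then show ?thesis unfolding g floor_double_div K(3) by (simp add: binary_digits_def)
    qed
    moreover have "card (g ` (K \<times> F n)) = (\<Prod>j<Suc n. card (F j))"
      using card_image[OF inj] K by (simp add: card_cartesian_product)
    moreover have "finite (g ` (K \<times> F n))" using K by (intro finite_imageI finite_cartesian_product) auto
    ultimately show ?case by blast
  qed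
  then obtain K where K: "finite K" "card K = (\<Prod>j<n. card (F j))" "A n = {t. \<lfloor>t * 2 ^ n\<rfloor> \<in> K}" by blast
  show "A n \<in> sets borel" unfolding K(3) by (rule emeasure_floor(1)[OF K(1)])
  show "emeasure lborel (A n) = (\<Prod>j<n. emeasure coin (F j))"
    unfolding K(3) emeasure_floor(2)[OF K(1)] emeasure_coin K(2)
    by (simp add: prod_ennreal prod_dividef)
qed

lemma measurable_binary_digits: "binary_digits \<in> lebesgue_on {0..1} \<rightarrow>\<^sub>M coins"
proof (rule measurable_coinsI)
  fix i
  have "(\<lambda>t. binary_digits t i) \<in> lborel \<rightarrow>\<^sub>M count_space UNIV"
  proof -
    have "(\<lambda>t :: real. \<lfloor>t * 2 ^ Suc i\<rfloor>) \<in> lborel \<rightarrow>\<^sub>M count_space UNIV"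
      by (rule measurable_compose[OF _ measurable_real_floor]) simp
    moreover have "(odd :: int \<Rightarrow> bool) \<in> count_space UNIV \<rightarrow>\<^sub>M count_space UNIV" by simp
    ultimately show ?thesis unfolding binary_digits_def by (rule measurable_compose)
  qed
  then show "(\<lambda>t. binary_digits t i) \<in> lebesgue_on {0..1} \<rightarrow>\<^sub>M count_space UNIV"
    by (rule measurable_restrict_space1[OF measurable_completion])
qed

lemma distr_binary_digits: "distr (lebesgue_on {0..1}) coins binary_digits = coins"
proof (rule measure_eq_coinsI)
  fix J :: "nat set" and F :: "nat \<Rightarrow> bool set" assume J: "finite J"
  obtain n where n: "J \<subseteq> {..<n}" using finite_nat_bounded[OF J] by blast
  \<comment> \<open>Padding with trivial conditions turns J into an initial segment of places; each
    added factor is 1.\<close>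
  define G where "G j = (if j \<in> J then F j else UNIV)" for j
  define A where "A = {t. 0 \<le> t \<and> t < 1 \<and> (\<forall>j<n. binary_digits t j \<in> G j)}"
  define S where "S = {t \<in> {0..1}. \<forall>j\<in>J. binary_digits t j \<in> F j}"
  have "A = {t. 0 \<le> t \<and> t < 1 \<and> (\<forall>j\<in>J. binary_digits t j \<in> F j)}"
    using n by (auto simp: A_def G_def)
  \<comment> \<open>The endpoint 1 lies outside the dyadic scheme, so S and A differ at most in this
    null point.\<close>
  then have S: "S = A \<union> (S \<inter> {1})" by (auto simp: S_def)
  have A: "A \<in> sets lborel"
    unfolding A_def sets_lborel by (rule emeasure_binary_digits)
  have null: "S \<inter> {1} \<in> null_sets lebesgue"
    by (cases "1 \<in> S") auto
  have "emeasure (distr (lebesgue_on {0..1}) coins binary_digits) {x. \<forall>j\<in>J. x j \<in> F j}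
      = emeasure (lebesgue_on {0..1}) S"
  proof -
    have "binary_digits -` {x. \<forall>j\<in>J. x j \<in> F j} \<inter> space (lebesgue_on {0..1}) = S"
      by (auto simp: S_def)
    then show ?thesis
      by (simp only: emeasure_distr[OF measurable_binary_digits sets_coins_cylinder[OF J]])
  qed
  also have "\<dots> = emeasure lebesgue S" by (rule emeasure_restrict_space) (auto simp: S_def)
  also have "\<dots> = emeasure lebesgue A"
    using emeasure_Un_null_set[OF sets_completionI_sets[OF A] null] S by (simp only:)
  also have "\<dots> = emeasure lborel A"
    by (simp only: emeasure_completion[OF sets_completionI_sets[OF A]] main_part[OF A])
  also have "\<dots> = (\<Prod>j<n. emeasure coin (G j))"
    unfolding A_def by (rule emeasure_binary_digits)
  also have "\<dots> = (\<Prod>j\<in>J. emeasure coin (F j))"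
    using n J by (intro prod.mono_neutral_cong_right) (auto simp: G_def emeasure_pmf)
  finally show "emeasure (distr (lebesgue_on {0..1}) coins binary_digits) {x. \<forall>j\<in>J. x j \<in> F j}
      = (\<Prod>j\<in>J. emeasure coin (F j))" .
qed simp

definition binary_value :: "(nat \<Rightarrow> bool) \<Rightarrow> real" where
  "binary_value x = (\<Sum>n. of_bool (x n) / 2 ^ Suc n)"

lemma measurable_binary_value: "binary_value \<in> borel_measurable coins"
  unfolding binary_value_def[abs_def] of_bool_def by measurable

text \<open>The partial sums equal \<open>\<lfloor>t * 2 ^ n\<rfloor> / 2 ^ n\<close>, which is
  within 1 / 2^n of t.\<close>

lemma binary_value_digits:
  assumes "0 \<le> t" "t < 1"
  shows "binary_value (binary_digits t) = t"
proof -
  have part: "(\<Sum>i<n. of_bool (binary_digits t i) / 2 ^ Suc i) = \<lfloor>t * 2 ^ n\<rfloor> / 2 ^ n" for n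
  proof (induction n)
    case 0
    then show ?case using assms by (simp add: floor_eq_iff)
  next
    case (Suc n)
    have "\<lfloor>t * 2 ^ Suc n\<rfloor> = 2 * \<lfloor>t * 2 ^ n\<rfloor> + of_bool (binary_digits t n)"
      using floor_double_div[of t n] by (simp add: binary_digits_def of_bool_def) presburger
    then have "real_of_int \<lfloor>t * 2 ^ Suc n\<rfloor> = 2 * real_of_int \<lfloor>t * 2 ^ n\<rfloor> + of_bool (binary_digits t n)"
      by simp
    then show ?case using Suc by (simp add: field_simps)
  qed
  have "(\<lambda>n. t - \<lfloor>t * 2 ^ n\<rfloor> / 2 ^ n) \<longlonglongrightarrow> 0"
  proof (rule Lim_null_comparison[OF always_eventually])
    show "\<forall>n. norm (t - \<lfloor>t * 2 ^ n\<rfloor> / 2 ^ n) \<le> (1 / 2) ^ n"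
    proof
      fix n
      have "t * 2 ^ n - 1 < \<lfloor>t * 2 ^ n\<rfloor>" "\<lfloor>t * 2 ^ n\<rfloor> \<le> t * 2 ^ n" by linarith+
      then have "\<bar>t * 2 ^ n - \<lfloor>t * 2 ^ n\<rfloor>\<bar> \<le> 1" by linarith
      then have "\<bar>t * 2 ^ n - \<lfloor>t * 2 ^ n\<rfloor>\<bar> / 2 ^ n \<le> 1 / 2 ^ n" by (rule divide_right_mono) simp
      moreover have "t - \<lfloor>t * 2 ^ n\<rfloor> / 2 ^ n = (t * 2 ^ n - \<lfloor>t * 2 ^ n\<rfloor>) / 2 ^ n" by (simp add: diff_divide_distrib)
      ultimately show "norm (t - \<lfloor>t * 2 ^ n\<rfloor> / 2 ^ n) \<le> (1 / 2) ^ n"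
        by (simp add: abs_divide power_divide)
    qed
    show "(\<lambda>n. (1 / 2) ^ n :: real) \<longlonglongrightarrow> 0" by (rule LIMSEQ_power_zero) simp
  qed
  then have "(\<lambda>n. \<lfloor>t * 2 ^ n\<rfloor> / 2 ^ n) \<longlonglongrightarrow> t"
    using tendsto_diff[OF tendsto_const[of t]] by fastforce
  then have "(\<lambda>i. of_bool (binary_digits t i) / 2 ^ Suc i) sums t"
    unfolding sums_def part .
  then show ?thesis unfolding binary_value_def by (rule sums_unique[symmetric])
qed

text \<open>Off a null set f is a Borel function of t, and t is recovered from its digits by
  \<open>binary_value\<close>. Passing to a Borel version first is essential, since composing a
  Lebesgue measurable function with a Borel map can destroy measurability.\<close>

lemma lebesgue_measurable_binary_digits:
  fixes f :: "real \<Rightarrow> complex"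
  assumes f: "f \<in> borel_measurable (lebesgue_on {0..1})"
  shows "\<exists>g\<in>borel_measurable coins. AE t in lebesgue_on {0..1}. f t = g (binary_digits t)"
proof -
  define F where "F t = (if t \<in> {0..1} then f t else 0)" for t
  have [measurable]: "F \<in> borel_measurable lebesgue"
    unfolding F_def using f by (intro borel_measurable_if_I) auto
  have "(\<lambda>t. Re (F t)) \<in> borel_measurable lebesgue" "(\<lambda>t. Im (F t)) \<in> borel_measurable lebesgue"
    by measurable
  from this[THEN completion_ex_borel_measurable_real] obtain u v
    where [measurable]: "u \<in> borel_measurable lborel" "v \<in> borel_measurable lborel"
      and uv: "AE t in lborel. Re (F t) = u t" "AE t in lborel. Im (F t) = v t" by blast
  define g where "g x = Complex (u (binary_value x)) (v (binary_value x))" for x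
  have "g \<in> borel_measurable coins"
  proof -
    have [measurable]: "u \<in> borel_measurable borel" "v \<in> borel_measurable borel"
      using \<open>u \<in> _\<close> \<open>v \<in> _\<close> by simp_all
    note [measurable] = measurable_binary_value
    have "g = (\<lambda>x. complex_of_real (u (binary_value x)) + \<i> * complex_of_real (v (binary_value x)))"
      by (auto simp: g_def complex_eq_iff)
    then show ?thesis by simp
  qed
  moreover have "AE t in lebesgue. t \<in> {0..1} \<longrightarrow> f t = g (binary_digits t)"
  proof -
    have "AE t in lborel. t \<noteq> 1" by (rule AE_lborel_singleton)
    then have "AE t in lborel. t \<in> {0..1} \<longrightarrow> f t = g (binary_digits t)"
      using uv
      by eventually_elim (auto simp: g_def F_def binary_value_digits complex_eq_iff)
    then show ?thesis by (rule AE_completion)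
  qed
  then have "AE t in lebesgue_on {0..1}. f t = g (binary_digits t)"
    by (subst AE_restrict_space_iff) auto
  ultimately show ?thesis by blast
qed

section \<open>Copies inside L_p[0,1], and the two cases combined\<close>

lemma is_Lp_space_almost_disjoint_copies:
  assumes p: "p > 1" and "is_Lp_space p TYPE('a::complex_normed_vector)"
  shows "almost_disjoint_copies TYPE('a)"
proof -
  have "Lp_functions p = Lp_on (lebesgue_on {0..1}) p" "Lp_seminorm p = Lp_norm (lebesgue_on {0..1}) p"
    by (auto simp: Lp_functions_def Lp_on_def Lp_seminorm_def Lp_norm_def)
  then obtain q :: "(real \<Rightarrow> complex) \<Rightarrow> 'a" where "Lp_quotient (lebesgue_on {0..1}) p q"
    using assms(2) unfolding is_Lp_space_def Lp_quotient_def by auto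
  from Lp_coins_almost_disjoint_copies[OF p Lp_quotient_transfer[OF p this measurable_binary_digits
        distr_binary_digits lebesgue_measurable_binary_digits]]
  show ?thesis .
qed

theorem theorem1p2:
  fixes \<psi> \<phi> :: "'x::complex_banach bounded_operator \<Rightarrow> 'y::complex_banach bounded_operator"
  assumes X_nonzero: "\<exists>x::'x. x \<noteq> 0"
    and Y_nonzero: "\<exists>y::'y. y \<noteq> 0"
    and Y_separable: "separable_space (euclidean :: 'y topology)"
    and Y_reflexive: "reflexive_space TYPE('y)"
    and X_cases: "(\<exists>p>1. is_Lp_space p TYPE('x)) \<or>
      (reflexive_space TYPE('x) \<and> (\<exists>b :: nat \<Rightarrow> 'x. subsymmetric_basis b))"
    and "algebra_hom \<psi>" and "algebra_hom \<phi>"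
    and "surj \<psi>"
    and "\<And>A. A \<noteq> 0 \<Longrightarrow> norm (\<psi> A - \<phi> A) < norm A"
  shows "banach_algebra_iso \<phi>"
proof -
  have "almost_disjoint_copies TYPE('x)"
    using X_cases is_Lp_space_almost_disjoint_copies subsymmetric_almost_disjoint_copies by blast
  then show ?thesis
    by (rule perturbed_hom_is_iso[OF X_nonzero Y_nonzero Y_separable Y_reflexive _ assms(6-9)])
qed

end
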